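(* Let $\mathbb F$ be an algebraically closed field, $G$ a Cayley bigraph on a finite group $\mathcal G$, and $L$ a subgraph of $G$. Then the generic maximum excess of $(L,G,\mathcal G,\mathbb F,\rho(L))$ is zero; equivalently, there is a nonempty Zariski open set $U\subset\mathbb F^{\rho(L)\times\mathcal G}$ such that every $M\in U$ is $L$-surjective and ${\rm m.e.}(\mathcal K_M(L))=0$.
   Context: Cayley bigraph on $\mathcal G$ with generators $g_1,g_2$: $V_G=\mathcal G$, $E_G=\mathcal G\times\{1,2\}$, edge $(g,i)$ has tail $g$, head $g_ig$. For $x\in\mathcal G$ and a subgraph $L$, $Lx$ is the image of $L$ under $g\mapsto gx$, $(g,i)\mapsto(gx,i)$; for $P\in V_G\sqcup E_G$, $\mathcal G_L(P)=\{x\in\mathcal G:P\in Lx\}$. For $k\ge0$ and $M\in\mathbb F^{k\times\mathcal G}$ with columns $m^x$, $M$ is $L$-surjective if for every $P$ the columns $m^x$, $x\in\mathcal G_L(P)$, span $\mathbb F^k$; then $\mathcal K_M(L)$ is the sheaf on $G$ with $\mathcal K_M(L)(P)=\{a\in\mathbb F^{\mathcal G}:a_x=0\ \forall x\notin\mathcal G_L(P),\ \sum_xa_xm^x=0\}$ and restriction maps the inclusions. The generic maximum excess of $(L,G,\mathcal G,\mathbb F,k)$ (for $k\le\rho(L)$) is the largest integer $m$ such that the set of $L$-surjective $M\in\mathbb F^{k\times\mathcal G}$ with ${\rm m.e.}(\mathcal K_M(L))\ge m$ is Zariski dense in $\mathbb F^{k\times\mathcal G}$. Maximum excess of a sheaf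 $\mathcal F$: with $\mathcal F(V)=\bigoplus_v\mathcal F(v)$, $d_h,d_t$ sending $\mathcal F(e)$ into $\mathcal F(he)$, $\mathcal F(te)$ by the restriction maps, $\Gamma_{\rm ht}(U)=\bigoplus_e\{w\in\mathcal F(e):d_hw,d_tw\in U\}$ and ${\rm m.e.}(\mathcal F)=\max_{U\subset\mathcal F(V)}(\dim\Gamma_{\rm ht}(U)-\dim U)$. $\rho(L)=\sum_X\max(0,|E_X|-|V_X|)$ over connected components $X$ of $L$ as an undirected graph. *)

theory Defs
  imports Main "HOL-Computational_Algebra.Polynomial" "HOL-Library.Function_Algebras"
begin

text \<open>Conventions. The finite group \<G> is a type 'g of class group_add and finite;
  its (not necessarily commutative) group product is written +. The field \<F> is a
  type 'f of class alg_closed_field. The two generators are g1 g2; the edge set of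
  the Cayley bigraph is \<G> \<times> {1,2} (edges are pairs (g,i) :: 'g \<times> nat with i \<in> {1,2}),
  the tail of (g,i) is g and its head is g_i g.\<close>

definition gen :: "'g \<Rightarrow> 'g \<Rightarrow> nat \<Rightarrow> 'g" where
  "gen g1 g2 i = (if i = 1 then g1 else g2)"

definition cayley_edges :: "('g \<times> nat) set" where
  "cayley_edges = UNIV \<times> {1,2}"

definition head :: "'g::group_add \<Rightarrow> 'g \<Rightarrow> 'g \<times> nat \<Rightarrow> 'g" where
  "head g1 g2 e = gen g1 g2 (snd e) + fst e"

definition tail :: "'g \<times> nat \<Rightarrow> 'g" where
  "tail e = fst e"

text \<open>A subgraph L = (VL, EL) of the Cayley bigraph.\<close>
definition is_subgraph :: "'g::group_add \<Rightarrow> 'g \<Rightarrow> 'g set \<Rightarrow> ('g \<times> nat) set \<Rightarrow> bool" where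
  "is_subgraph g1 g2 VL EL \<longleftrightarrow> EL \<subseteq> cayley_edges \<and>
     (\<forall>e\<in>EL. tail e \<in> VL \<and> head g1 g2 e \<in> VL)"

text \<open>\<G>_L(P) for a vertex v resp. an edge e: the x with P \<in> Lx.\<close>
definition GL_vert :: "'g::group_add set \<Rightarrow> 'g \<Rightarrow> 'g set" where
  "GL_vert VL v = {x. v \<in> (\<lambda>g. g + x) ` VL}"

definition GL_edge :: "('g::group_add \<times> nat) set \<Rightarrow> 'g \<times> nat \<Rightarrow> 'g set" where
  "GL_edge EL e = {x. e \<in> (\<lambda>(g,i). (g + x, i)) ` EL}"

text \<open>\<rho>(L): sum over connected components X of L (as an undirected graph) of
  max(0, |E_X| - |V_X|).\<close>
definition adj :: "'g::group_add \<Rightarrow> 'g \<Rightarrow> ('g \<times> nat) set \<Rightarrow> ('g \<times> 'g) set" where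
  "adj g1 g2 EL = {(tail e, head g1 g2 e) | e. e \<in> EL}"

definition components :: "'g::group_add \<Rightarrow> 'g \<Rightarrow> 'g set \<Rightarrow> ('g \<times> nat) set \<Rightarrow> 'g set set" where
  "components g1 g2 VL EL = VL // ((adj g1 g2 EL \<union> (adj g1 g2 EL)\<inverse>)\<^sup>*)"

definition rho :: "'g::group_add \<Rightarrow> 'g \<Rightarrow> 'g set \<Rightarrow> ('g \<times> nat) set \<Rightarrow> nat" where
  "rho g1 g2 VL EL = (\<Sum>X\<in>components g1 g2 VL EL.
      nat (max 0 (int (card {e\<in>EL. tail e \<in> X}) - int (card X))))"

text \<open>Linear algebra on spaces of functions _ \<Rightarrow> 'f with pointwise operations.\<close>
definition fscale :: "'f::field \<Rightarrow> ('a \<Rightarrow> 'f) \<Rightarrow> ('a \<Rightarrow> 'f)" where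
  "fscale c v = (\<lambda>a. c * v a)"

definition fdim :: "('a \<Rightarrow> 'f::field) set \<Rightarrow> nat" where
  "fdim S = vector_space.dim fscale S"

definition fsubspace :: "('a \<Rightarrow> 'f::field) set \<Rightarrow> bool" where
  "fsubspace S = module.subspace fscale S"

definition fspan :: "('a \<Rightarrow> 'f::field) set \<Rightarrow> ('a \<Rightarrow> 'f) set" where
  "fspan S = module.span fscale S"

text \<open>Matrices M \<in> \<F>^{k\<times>\<G>}: M i x is the entry in row i < k, column x;
  entries with i \<ge> k are zero. The column m^x is an element of \<F>^k,
  represented as nat \<Rightarrow> 'f vanishing at indices \<ge> k.\<close>
definition mats :: "nat \<Rightarrow> (nat \<Rightarrow> 'g \<Rightarrow> 'f::zero) set" where
  "mats k = {M. \<forall>i x. k \<le> i \<longrightarrow> M i x = 0}"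

definition Fk :: "nat \<Rightarrow> (nat \<Rightarrow> 'f::zero) set" where
  "Fk k = {v. \<forall>i. k \<le> i \<longrightarrow> v i = 0}"

definition col :: "(nat \<Rightarrow> 'g \<Rightarrow> 'f) \<Rightarrow> 'g \<Rightarrow> nat \<Rightarrow> 'f" where
  "col M x = (\<lambda>i. M i x)"

text \<open>Zariski topology on \<F>^{k\<times>\<G>}: polynomial functions in the coordinates M i x (i<k).\<close>
inductive_set polyfun :: "nat \<Rightarrow> ((nat \<Rightarrow> 'g \<Rightarrow> 'f::comm_ring_1) \<Rightarrow> 'f) set" for k where
  pconst: "(\<lambda>M. c) \<in> polyfun k"
| pvar: "i < k \<Longrightarrow> (\<lambda>M. M i x) \<in> polyfun k"
| padd: "p \<in> polyfun k \<Longrightarrow> q \<in> polyfun k \<Longrightarrow> (\<lambda>M. p M + q M) \<in> polyfun k"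
| pmult: "p \<in> polyfun k \<Longrightarrow> q \<in> polyfun k \<Longrightarrow> (\<lambda>M. p M * q M) \<in> polyfun k"

text \<open>S is Zariski dense in \<F>^{k\<times>\<G>}: every polynomial vanishing on S vanishes everywhere.\<close>
definition zariski_dense :: "nat \<Rightarrow> (nat \<Rightarrow> 'g \<Rightarrow> 'f::comm_ring_1) set \<Rightarrow> bool" where
  "zariski_dense k S \<longleftrightarrow> S \<subseteq> mats k \<and>
     (\<forall>p\<in>polyfun k. (\<forall>M\<in>S. p M = 0) \<longrightarrow> (\<forall>M\<in>mats k. p M = 0))"

text \<open>L-surjectivity.\<close>
definition L_surjective :: "'g::group_add \<Rightarrow> 'g \<Rightarrow> 'g set \<Rightarrow> ('g \<times> nat) set \<Rightarrow> nat
    \<Rightarrow> (nat \<Rightarrow> 'g \<Rightarrow> 'f::field) \<Rightarrow> bool" where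
  "L_surjective g1 g2 VL EL k M \<longleftrightarrow>
     (\<forall>v. fspan (col M ` GL_vert VL v) = Fk k) \<and>
     (\<forall>e\<in>cayley_edges. fspan (col M ` GL_edge EL e) = Fk k)"

text \<open>The sheaf K_M(L): value at a vertex/edge with \<G>_L(P) = A.\<close>
definition Kval :: "nat \<Rightarrow> (nat \<Rightarrow> 'g::finite \<Rightarrow> 'f::field) \<Rightarrow> 'g set \<Rightarrow> ('g \<Rightarrow> 'f) set" where
  "Kval k M A = {a. (\<forall>x. x \<notin> A \<longrightarrow> a x = 0) \<and> (\<forall>i<k. (\<Sum>x\<in>UNIV. a x * M i x) = 0)}"

definition KV :: "'g::{group_add,finite} set \<Rightarrow> nat \<Rightarrow> (nat \<Rightarrow> 'g \<Rightarrow> 'f::field) \<Rightarrow> 'g \<Rightarrow> ('g \<Rightarrow> 'f) set" where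
  "KV VL k M v = Kval k M (GL_vert VL v)"

definition KE :: "('g::{group_add,finite} \<times> nat) set \<Rightarrow> nat \<Rightarrow> (nat \<Rightarrow> 'g \<Rightarrow> 'f::field) \<Rightarrow> 'g \<times> nat \<Rightarrow> ('g \<Rightarrow> 'f) set" where
  "KE EL k M e = Kval k M (GL_edge EL e)"

text \<open>Maximum excess of K_M(L). F(V) = \<Oplus>_v F(v) is represented by functions
  u :: 'g \<times> 'g \<Rightarrow> 'f with u(v,_) \<in> F(v); \<Gamma>_ht(U) = \<Oplus>_e {...} by functions
  w :: ('g \<times> nat) \<times> 'g \<Rightarrow> 'f with w(e,_) in the prescribed subspace for each edge e
  and w(e,_) = 0 for non-edges e. d_h, d_t insert w \<in> F(e) into the component
  of the head resp. tail of e (restriction maps are inclusions).\<close>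
definition FV :: "'g::{group_add,finite} set \<Rightarrow> nat \<Rightarrow> (nat \<Rightarrow> 'g \<Rightarrow> 'f::field) \<Rightarrow> ('g \<times> 'g \<Rightarrow> 'f) set" where
  "FV VL k M = {u. \<forall>v. (\<lambda>x. u (v, x)) \<in> KV VL k M v}"

definition dins :: "'g \<Rightarrow> ('g \<Rightarrow> 'f::zero) \<Rightarrow> ('g \<times> 'g \<Rightarrow> 'f)" where
  "dins v w = (\<lambda>(v', x). if v' = v then w x else 0)"

definition d_h :: "'g::group_add \<Rightarrow> 'g \<Rightarrow> 'g \<times> nat \<Rightarrow> ('g \<Rightarrow> 'f::zero) \<Rightarrow> ('g \<times> 'g \<Rightarrow> 'f)" where
  "d_h g1 g2 e w = dins (head g1 g2 e) w"

definition d_t :: "'g \<times> nat \<Rightarrow> ('g \<Rightarrow> 'f::zero) \<Rightarrow> ('g \<times> 'g \<Rightarrow> 'f)" where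
  "d_t e w = dins (tail e) w"

definition Gamma_ht :: "'g::{group_add,finite} \<Rightarrow> 'g \<Rightarrow> ('g \<times> nat) set \<Rightarrow> nat
    \<Rightarrow> (nat \<Rightarrow> 'g \<Rightarrow> 'f::field) \<Rightarrow> ('g \<times> 'g \<Rightarrow> 'f) set \<Rightarrow> (('g \<times> nat) \<times> 'g \<Rightarrow> 'f) set" where
  "Gamma_ht g1 g2 EL k M U = {w.
     (\<forall>e. e \<notin> cayley_edges \<longrightarrow> (\<forall>x. w (e, x) = 0)) \<and>
     (\<forall>e\<in>cayley_edges. (\<lambda>x. w (e, x)) \<in> KE EL k M e \<and>
        d_h g1 g2 e (\<lambda>x. w (e, x)) \<in> U \<and> d_t e (\<lambda>x. w (e, x)) \<in> U)}"

definition max_excess :: "'g::{group_add,finite} \<Rightarrow> 'g \<Rightarrow> 'g set \<Rightarrow> ('g \<times> nat) set \<Rightarrow> nat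
    \<Rightarrow> (nat \<Rightarrow> 'g \<Rightarrow> 'f::field) \<Rightarrow> int" where
  "max_excess g1 g2 VL EL k M = Max {int (fdim (Gamma_ht g1 g2 EL k M U)) - int (fdim U) | U.
      fsubspace U \<and> U \<subseteq> FV VL k M}"

text \<open>Generic maximum excess of (L, G, \<G>, \<F>, k).\<close>
definition generic_max_excess :: "'g::{group_add,finite} \<Rightarrow> 'g \<Rightarrow> 'g set \<Rightarrow> ('g \<times> nat) set
    \<Rightarrow> 'f::field itself \<Rightarrow> nat \<Rightarrow> int" where
  "generic_max_excess g1 g2 VL EL F k = (GREATEST m. zariski_dense k
      {M :: nat \<Rightarrow> 'g \<Rightarrow> 'f. M \<in> mats k \<and> L_surjective g1 g2 VL EL k M \<and>
         max_excess g1 g2 VL EL k M \<ge> m})"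

end

theory Submission
  imports Defs "HOL-Library.Countable"
begin

text \<open>The proof follows Friedman. The maximum excess is attained by a least maximizer, a family of
  subspaces of the stalks determined by the matrix. Right translations permute the columns of the matrix
  and carry least maximizers to least maximizers, so that for a generic matrix the dimensions of the least
  maximizer do not depend on the vertex and the generic maximum excess is a multiple of the group order.
  A further generic row annihilates the least maximizer only if the latter is zero; hence every row lowers a
  positive generic maximum excess by at least the group order. Without rows it is at most
  \<open>\<rho>(L)\<close> times the group order, so it vanishes after \<open>\<rho>(L)\<close> rows.

  That every constructible condition or its negation holds on a nonempty open set, which is needed to
  speak of generic values, is obtained from Chevalley's theorem on projections.\<close>

section \<open>Constructible conditions\<close>

text \<open>Any maximizer attains the maximum; the least one is singled out because it is canonical.
  Canonicity makes it equivariant under translation, makes membership in it expressible as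
  membership in every maximizer, and places it inside the least maximizer for one more row whenever
  that row leaves the maximum unchanged.

  The obstacle is that its definition quantifies over families of subspaces, so its dependence on
  the matrix is not visibly algebraic. Families are therefore coded by spanning vectors and
  dimensions by leading positions; both become first-order conditions over the field.

  The constant \<rho>(L) times the group order also comes from leading positions: the excess is at
  most a sum, over the group elements x, of edges minus vertices in an induced subgraph of L, and
  each term is at most \<rho>(L). A strict drop between two multiples of the group order is at least
  the group order, so \<rho>(L) rows exhaust this bound.

  Assignments are indexed by all of \<open>nat \<times> 'g\<close>, so that matrices with different
  numbers of rows share one coordinate space.\<close>

inductive_set polynomial_fun :: "(('v \<Rightarrow> 'f::comm_ring_1) \<Rightarrow> 'f) set" where
  polynomial_fun_const: "(\<lambda>s. c) \<in> polynomial_fun"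
| polynomial_fun_var: "(\<lambda>s. s v) \<in> polynomial_fun"
| polynomial_fun_add: "p \<in> polynomial_fun \<Longrightarrow> q \<in> polynomial_fun \<Longrightarrow> (\<lambda>s. p s + q s) \<in> polynomial_fun"
| polynomial_fun_mult: "p \<in> polynomial_fun \<Longrightarrow> q \<in> polynomial_fun \<Longrightarrow> (\<lambda>s. p s * q s) \<in> polynomial_fun"

lemma polynomial_fun_uminus: "p \<in> polynomial_fun \<Longrightarrow> (\<lambda>s. - p s) \<in> polynomial_fun"
  using polynomial_fun_mult[OF polynomial_fun_const[of "-1"], of p] by simp

lemma polynomial_fun_diff: "p \<in> polynomial_fun \<Longrightarrow> q \<in> polynomial_fun \<Longrightarrow> (\<lambda>s. p s - q s) \<in> polynomial_fun"
  using polynomial_fun_add[OF _ polynomial_fun_uminus, of p q] by simp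

lemma polynomial_fun_sum: "(\<And>i. i \<in> I \<Longrightarrow> p i \<in> polynomial_fun) \<Longrightarrow> (\<lambda>s. \<Sum>i\<in>I. p i s) \<in> polynomial_fun"
  by (induction I rule: infinite_finite_induct) (auto intro: polynomial_fun_const polynomial_fun_add)

lemma polynomial_fun_subst:
  assumes "p \<in> polynomial_fun" "\<And>v. (\<lambda>s. f s v) \<in> polynomial_fun"
  shows "(\<lambda>s. p (f s)) \<in> polynomial_fun"
  using assms(1)
  by (induction rule: polynomial_fun.induct) (auto intro: polynomial_fun_const polynomial_fun_add polynomial_fun_mult assms(2))

text \<open>Conditions are predicates on assignments of the coordinates, so that a quantifier over
  vectors becomes a quantifier over additional coordinates (a sum type of variables).\<close>

inductive constructible :: "(('v \<Rightarrow> 'f::comm_ring_1) \<Rightarrow> bool) \<Rightarrow> bool" where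
  constructible_zero: "p \<in> polynomial_fun \<Longrightarrow> constructible (\<lambda>s. p s = 0)"
| constructible_not: "constructible \<phi> \<Longrightarrow> constructible (\<lambda>s. \<not> \<phi> s)"
| constructible_conj: "constructible \<phi> \<Longrightarrow> constructible \<psi> \<Longrightarrow> constructible (\<lambda>s. \<phi> s \<and> \<psi> s)"

lemma constructible_const: "constructible (\<lambda>s. b)"
proof (cases b)
  case True
  then show ?thesis using constructible_zero[OF polynomial_fun_const[of 0]] by simp
next
  case False
  then show ?thesis using constructible_zero[OF polynomial_fun_const[of 1]] by simp
qed

lemma constructible_eq: "p \<in> polynomial_fun \<Longrightarrow> q \<in> polynomial_fun \<Longrightarrow> constructible (\<lambda>s. p s = q s)"
  using constructible_zero[OF polynomial_fun_diff, of p q] by simp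

lemma constructible_disj:
  assumes "constructible \<phi>" "constructible \<psi>"
  shows "constructible (\<lambda>s. \<phi> s \<or> \<psi> s)"
proof -
  have "constructible (\<lambda>s. \<not> (\<not> \<phi> s \<and> \<not> \<psi> s))"
    by (rule constructible_not[OF constructible_conj[OF constructible_not[OF assms(1)] constructible_not[OF assms(2)]]])
  then show ?thesis by simp
qed

lemma constructible_imp:
  assumes "constructible \<phi>" "constructible \<psi>"
  shows "constructible (\<lambda>s. \<phi> s \<longrightarrow> \<psi> s)"
  using constructible_disj[OF constructible_not[OF assms(1)] assms(2)] by simp

lemma constructible_ball: "finite I \<Longrightarrow> (\<And>i. i \<in> I \<Longrightarrow> constructible (\<phi> i)) \<Longrightarrow> constructible (\<lambda>s. \<forall>i\<in>I. \<phi> i s)"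
  by (induction I rule: finite_induct) (auto intro: constructible_const constructible_conj)

lemma constructible_bex: "finite I \<Longrightarrow> (\<And>i. i \<in> I \<Longrightarrow> constructible (\<phi> i)) \<Longrightarrow> constructible (\<lambda>s. \<exists>i\<in>I. \<phi> i s)"
  by (induction I rule: finite_induct) (auto intro: constructible_const constructible_disj)

lemma constructible_subst:
  assumes "constructible \<phi>" "\<And>v. (\<lambda>s. f s v) \<in> polynomial_fun"
  shows "constructible (\<lambda>s. \<phi> (f s))"
  using assms(1)
proof (induction rule: constructible.induct)
  case (constructible_zero p)
  then show ?case using constructible.constructible_zero[OF polynomial_fun_subst[OF constructible_zero assms(2)]] by simp
next
  case (constructible_not \<phi>)
  show ?case by (rule constructible.constructible_not[OF constructible_not.IH])
next
  case (constructible_conj \<phi> \<psi>)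
  show ?case by (rule constructible.constructible_conj[OF constructible_conj.IH])
qed

text \<open>Polynomials in one variable whose coefficients are polynomial functions of the
  parameters. The bound \<open>m\<close> on the degree is strict and formal: for a member of
  \<open>poly_family (Suc n)\<close> the coefficient at \<open>n\<close> may vanish at some
  parameters and not at others.\<close>

definition poly_family :: "nat \<Rightarrow> (('v \<Rightarrow> 'f::comm_ring_1) \<Rightarrow> 'f poly) set" where
  "poly_family m = {P. \<forall>i. (\<lambda>s. coeff (P s) i) \<in> polynomial_fun \<and> (m \<le> i \<longrightarrow> (\<forall>s. coeff (P s) i = 0))}"

lemma poly_family_mono: "P \<in> poly_family m \<Longrightarrow> m \<le> n \<Longrightarrow> P \<in> poly_family n"
  by (auto simp: poly_family_def)

lemma poly_family_0: "P \<in> poly_family 0 \<Longrightarrow> P s = 0"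
  by (intro poly_eqI) (simp add: poly_family_def)

lemma poly_family_const: "p \<in> polynomial_fun \<Longrightarrow> (\<lambda>s. [:p s:]) \<in> poly_family 1"
proof -
  assume p: "p \<in> polynomial_fun"
  have "(\<lambda>s. coeff [:p s:] i) \<in> polynomial_fun" for i
    using p by (cases i) (auto intro: polynomial_fun_const)
  moreover have "coeff [:p s:] i = 0" if "1 \<le> i" for s i
    using that by (cases i) auto
  ultimately show ?thesis by (simp add: poly_family_def)
qed

lemma poly_family_add: "P \<in> poly_family m \<Longrightarrow> Q \<in> poly_family n \<Longrightarrow> (\<lambda>s. P s + Q s) \<in> poly_family (max m n)"
  by (auto simp: poly_family_def intro: polynomial_fun_add)

lemma poly_family_mult: "P \<in> poly_family m \<Longrightarrow> Q \<in> poly_family n \<Longrightarrow> (\<lambda>s. P s * Q s) \<in> poly_family (m + n)"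
  unfolding poly_family_def mem_Collect_eq
proof (intro allI conjI impI)
  fix i s
  assume P: "\<forall>i. (\<lambda>s. coeff (P s) i) \<in> polynomial_fun \<and> (m \<le> i \<longrightarrow> (\<forall>s. coeff (P s) i = 0))"
    and Q: "\<forall>i. (\<lambda>s. coeff (Q s) i) \<in> polynomial_fun \<and> (n \<le> i \<longrightarrow> (\<forall>s. coeff (Q s) i = 0))"
  show "(\<lambda>s. coeff (P s * Q s) i) \<in> polynomial_fun"
    unfolding coeff_mult using P Q by (intro polynomial_fun_sum polynomial_fun_mult) auto
  assume i: "m + n \<le> i"
  have "coeff (P s) j * coeff (Q s) (i - j) = 0" if "j \<le> i" for j
    using P Q i that by (cases "m \<le> j") auto
  then show "coeff (P s * Q s) i = 0"
    unfolding coeff_mult by (intro sum.neutral) auto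
qed

lemma poly_family_power: "P \<in> poly_family m \<Longrightarrow> (\<lambda>s. P s ^ k) \<in> poly_family (Suc (k * m))"
proof (induction k)
  case 0
  then show ?case using poly_family_const[OF polynomial_fun_const[of 1]] by (simp add: one_pCons)
next
  case (Suc k)
  then show ?case using poly_family_mult[of P m "\<lambda>s. P s ^ k" "Suc (k * m)"] by simp
qed

text \<open>Serves the branch in which the coefficient at \<open>m\<close> vanishes: there the
  truncation is \<open>P s\<close> itself, with a smaller formal degree.\<close>

lemma poly_family_truncate:
  assumes "P \<in> poly_family (Suc m)"
  shows "(\<lambda>s. P s - monom (coeff (P s) m) m) \<in> poly_family m"
proof -
  have "(\<lambda>s. coeff (P s) i - (if m = i then coeff (P s) m else 0)) \<in> polynomial_fun" for i
    using assms by (cases "m = i") (auto simp: poly_family_def intro: polynomial_fun_const)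
  moreover have "coeff (P s) i = 0" if "m \<le> i" "m \<noteq> i" for s i
    using that assms by (auto simp: poly_family_def)
  ultimately show ?thesis
    by (auto simp: poly_family_def)
qed

lemma poly_family_expand:
  assumes "p \<in> polynomial_fun"
  shows "\<exists>m P. P \<in> poly_family m \<and> (\<forall>s a. poly (P s) a = p (s(n := a)))"
  using assms
proof (induction rule: polynomial_fun.induct)
  case (polynomial_fun_const c)
  show ?case using poly_family_const[OF polynomial_fun.polynomial_fun_const[of c]] by force
next
  case (polynomial_fun_var v)
  have "(\<lambda>s. [:0, 1:]) \<in> poly_family 2"
    by (auto simp: poly_family_def coeff_pCons split: nat.split intro: polynomial_fun.polynomial_fun_const)
  then show ?case
    using poly_family_const[OF polynomial_fun.polynomial_fun_var[of v]] by (cases "v = n") force+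
next
  case (polynomial_fun_add p q)
  then obtain m P n' Q where "P \<in> poly_family m" "Q \<in> poly_family n'"
    "\<forall>s a. poly (P s) a = p (s(n := a))" "\<forall>s a. poly (Q s) a = q (s(n := a))"
    by blast
  then show ?case using poly_family_add[of P m Q n']
    by (intro exI[of _ "max m n'"] exI[of _ "\<lambda>s. P s + Q s"]) (simp del: fun_upd_apply)
next
  case (polynomial_fun_mult p q)
  then obtain m P n' Q where "P \<in> poly_family m" "Q \<in> poly_family n'"
    "\<forall>s a. poly (P s) a = p (s(n := a))" "\<forall>s a. poly (Q s) a = q (s(n := a))"
    by blast
  then show ?case using poly_family_mult[of P m Q n']
    by (intro exI[of _ "m + n'"] exI[of _ "\<lambda>s. P s * Q s"]) (simp del: fun_upd_apply)
qed

text \<open>Multiplying by the leading coefficient instead of dividing by it keeps the coefficients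
  of the remainder polynomial in the parameters. The scalar \<open>c\<close> is a power of that
  coefficient, hence nonzero where the coefficient is. Only \<open>R'\<close> has to vary
  polynomially; \<open>c\<close> and \<open>T\<close> are chosen separately for each
  \<open>s\<close>.\<close>

lemma poly_family_pseudo_rem:
  assumes P: "P \<in> poly_family (Suc m)" and "R \<in> poly_family d"
  shows "\<exists>R'\<in>poly_family m. \<forall>s. coeff (P s) m \<noteq> 0 \<longrightarrow>
    (\<exists>c T. c \<noteq> 0 \<and> smult c (R s) = P s * T + R' (s :: 'v \<Rightarrow> 'f::idom))"
proof -
  have trivial: "\<exists>c T. c \<noteq> 0 \<and> smult c (R s) = P s * T + R s" for R s
    by (rule exI[of _ 1], rule exI[of _ 0]) simp
  show ?thesis
    using assms(2)
  proof (induction d arbitrary: R)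
    case 0
    then show ?case
      using trivial by (intro bexI[of _ R]) (auto intro: poly_family_mono)
  next
    case (Suc d)
    show ?case
    proof (cases "Suc d \<le> m")
      case True
      then show ?thesis using Suc.prems
        using trivial by (intro bexI[of _ R]) (auto intro: poly_family_mono)
    next
      case False
      \<comment> \<open>Cross-multiplication of the two formally leading coefficients cancels the
        coefficient at \<open>d\<close>.\<close>
      define R1 where "R1 s = smult (coeff (P s) m) (R s) - monom (coeff (R s) d) (d - m) * P s" for s
      have "R1 \<in> poly_family d"
        unfolding poly_family_def mem_Collect_eq
      proof (intro allI conjI impI)
        fix i s
        have pP: "(\<lambda>s. coeff (P s) i) \<in> polynomial_fun" "(\<lambda>s. coeff (R s) i) \<in> polynomial_fun" for i
          using P Suc.prems by (auto simp: poly_family_def)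
        show "(\<lambda>s. coeff (R1 s) i) \<in> polynomial_fun"
          unfolding R1_def coeff_diff coeff_smult
          by (cases "d - m \<le> i")
            (auto simp: coeff_monom_mult intro!: polynomial_fun_diff polynomial_fun_mult pP polynomial_fun_const)
        assume "d \<le> i"
        then show "coeff (R1 s) i = 0"
        proof (cases "i = d")
          case True
          then show ?thesis using False by (simp add: R1_def coeff_monom_mult)
        next
          case i: False
          then have "coeff (R s) i = 0" "coeff (P s) (i - (d - m)) = 0"
            using \<open>d \<le> i\<close> False P Suc.prems by (auto simp: poly_family_def)
          then show ?thesis by (simp add: R1_def coeff_monom_mult)
        qed
      qed
      from Suc.IH[OF this] obtain R' where R': "R' \<in> poly_family m"
        "\<forall>s. coeff (P s) m \<noteq> 0 \<longrightarrow> (\<exists>c T. c \<noteq> 0 \<and> smult c (R1 s) = P s * T + R' s)"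
        by (rule bexE)
      show ?thesis
      proof (intro bexI[OF _ R'(1)] allI impI)
        fix s assume s: "coeff (P s) m \<noteq> 0"
        from R'(2)[rule_format, OF s] obtain c T where c: "c \<noteq> 0" "smult c (R1 s) = P s * T + R' s" by blast
        have "smult (c * coeff (P s) m) (R s)
          = smult c (R1 s) + P s * smult c (monom (coeff (R s) d) (d - m))"
          by (simp add: R1_def smult_diff_right algebra_simps)
        also have "\<dots> = P s * (T + smult c (monom (coeff (R s) d) (d - m))) + R' s"
          unfolding c(2) by (simp add: algebra_simps)
        finally show "\<exists>c T. c \<noteq> 0 \<and> smult c (R s) = P s * T + R' s"
          using c(1) s by (intro exI[of _ "c * coeff (P s) m"] exI conjI) auto
      qed
    qed
qed
qed

lemma constructible_poly_family_zero: "P \<in> poly_family m \<Longrightarrow> constructible (\<lambda>s. P s = 0)"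
proof -
  assume P: "P \<in> poly_family m"
  have "constructible (\<lambda>s. \<forall>i\<in>{..<m}. coeff (P s) i = 0)"
    using P by (intro constructible_ball constructible_zero) (auto simp: poly_family_def)
  moreover have "(\<forall>i\<in>{..<m}. coeff (P s) i = 0) \<longleftrightarrow> P s = 0" for s
  proof
    assume *: "\<forall>i\<in>{..<m}. coeff (P s) i = 0"
    show "P s = 0"
    proof (rule poly_eqI)
      fix i
      show "coeff (P s) i = coeff 0 i" using P * by (cases "i < m") (auto simp: poly_family_def)
    qed
  qed simp
  ultimately show ?thesis by simp
qed

text \<open>Over an algebraically closed field, a polynomial \<open>p\<close> has a root outside the zero set of \<open>q\<close>
  iff \<open>p\<close> does not divide \<open>q ^ degree p\<close>; divisibility is read off a pseudo-remainder.\<close>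

lemma dvd_power_if_roots:
  fixes p q :: "'f::alg_closed_field poly"
  assumes "p \<noteq> 0" "degree p \<le> n" "\<And>a. poly p a = 0 \<Longrightarrow> poly q a = 0"
  shows "p dvd q ^ n"
  using assms
proof (induction n arbitrary: p)
  case 0
  then have "is_unit p" by (simp add: is_unit_iff_degree)
  then show ?case by auto
next
  case (Suc n)
  show ?case
  proof (cases "degree p = 0")
    case True
    then have "is_unit p" using Suc.prems by (simp add: is_unit_iff_degree)
    then show ?thesis using unit_imp_dvd by blast
  next
    case False
    then obtain a where a: "poly p a = 0"
      using alg_closed_imp_poly_has_root by blast
    then obtain r where r: "p = [:-a, 1:] * r"
      by (meson dvdE poly_eq_0_iff_dvd)
    have "r \<noteq> 0" using r Suc.prems(1) by auto
    moreover have "degree r \<le> n"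
      using r \<open>r \<noteq> 0\<close> Suc.prems(2) by (auto simp: degree_mult_eq simp del: mult_pCons_left)
    ultimately have "r dvd q ^ n"
      using Suc.prems(3) by (intro Suc.IH) (auto simp: r)
    moreover have "[:-a, 1:] dvd q"
      using Suc.prems(3)[OF a] poly_eq_0_iff_dvd by blast
    ultimately show ?thesis
      unfolding r power_Suc by (rule mult_dvd_mono[rotated])
  qed
qed

text \<open>Over a finite field, one plus the product of all \<open>[:-a, 1:]\<close> would be a
  nonconstant polynomial without a root.\<close>

lemma alg_closed_infinite: "infinite (UNIV :: 'f::alg_closed_field set)"
proof
  assume fin: "finite (UNIV :: 'f set)"
  define p :: "'f poly" where "p = (\<Prod>a\<in>UNIV. [:-a, 1:])"
  have "degree p = card (UNIV :: 'f set)"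
    unfolding p_def by (subst degree_prod_eq_sum_degree) auto
  then have "degree p > 0" using fin by (simp add: card_gt_0_iff)
  then have "degree (p + 1) > 0" by (simp add: degree_add_eq_left)
  then obtain x where "poly (p + 1) x = 0" using alg_closed_imp_poly_has_root by blast
  moreover have "poly p x = 0"
    unfolding p_def poly_prod using fin by (simp add: prod_zero_iff)
  ultimately show False by simp
qed

lemma poly_nonroot_exists:
  fixes q :: "'f::alg_closed_field poly"
  assumes "q \<noteq> 0"
  shows "\<exists>a. poly q a \<noteq> 0"
proof (rule ccontr)
  assume "\<nexists>a. poly q a \<noteq> 0"
  then have "{a. poly q a = 0} = UNIV" by auto
  then show False using poly_roots_finite[OF assms] alg_closed_infinite[where 'f='f] by simp
qed

text \<open>Chevalley's theorem for one variable. Euclid's algorithm is run on families of polynomials, with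
  a case distinction whether the formally leading coefficient vanishes; the formal degrees decrease.\<close>

lemma constructible_ex_root:
  fixes xs :: "(nat \<times> (('v \<Rightarrow> 'f::alg_closed_field) \<Rightarrow> 'f poly)) list"
  assumes "\<And>m P. (m, P) \<in> set xs \<Longrightarrow> P \<in> poly_family m" and Q: "Q \<in> poly_family d"
  shows "constructible (\<lambda>s. \<exists>a. (\<forall>(m, P)\<in>set xs. poly (P s) a = 0) \<and> poly (Q s) a \<noteq> 0)"
  using assms(1)
\<comment> \<open>The summand is \<open>Suc m\<close> so that discarding an equation of formal
  degree bound 0, which is identically satisfied, also decreases the measure.\<close>
proof (induction "\<Sum>(m, P)\<leftarrow>xs. Suc m" arbitrary: xs rule: less_induct)
  case (less xs)
  consider "xs = []" | m P where "xs = [(m, P)]" | m P m' P' ys where "xs = (m, P) # (m', P') # ys"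
    by (metis neq_Nil_conv surj_pair)
  then show ?case
  proof cases
    case 1
    have "(\<exists>a. poly (Q s) a \<noteq> 0) \<longleftrightarrow> \<not> Q s = 0" for s
      using poly_nonroot_exists[of "Q s"] by auto
    then show ?thesis using constructible_not[OF constructible_poly_family_zero[OF Q]] 1 by simp
  next
    case (2 m P)
    have P: "P \<in> poly_family m" using less.prems 2 by simp
    show ?thesis
    proof (cases m)
      case 0
      have "constructible (\<lambda>s. \<exists>a. poly (Q s) a \<noteq> 0)"
        using less.hyps[of "[]"] by (simp add: 2)
      then show ?thesis using poly_family_0[of P] P 2 0 by simp
    next
      case (Suc n)
      let ?T = "\<lambda>s. P s - monom (coeff (P s) n) n"
      have T: "?T \<in> poly_family n" using poly_family_truncate P Suc by blast
      have "constructible (\<lambda>s. \<exists>a. (\<forall>(m, P)\<in>set [(n, ?T)]. poly (P s) a = 0) \<and> poly (Q s) a \<noteq> 0)"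
        by (rule less.hyps) (use T in \<open>auto simp: 2 Suc\<close>)
      then have c1: "constructible (\<lambda>s. \<exists>a. poly (?T s) a = 0 \<and> poly (Q s) a \<noteq> 0)" by simp
      obtain R where R: "R \<in> poly_family n" "\<And>s. coeff (P s) n \<noteq> 0 \<Longrightarrow>
        \<exists>c T. c \<noteq> 0 \<and> smult c (Q s ^ n) = P s * T + R s"
        using poly_family_pseudo_rem[OF P[unfolded Suc] poly_family_power[OF Q, of n]] by blast
      have c0: "constructible (\<lambda>s. coeff (P s) n = 0)"
        using P by (intro constructible_zero) (auto simp: poly_family_def)
      \<comment> \<open>Where the coefficient at \<open>n\<close> is nonzero, \<open>n\<close> is
        the exact degree of \<open>P s\<close>, which justifies the exponent \<open>n\<close>. As
        \<open>R s\<close> has no coefficient from \<open>n\<close> on, it vanishes exactly when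
        \<open>P s\<close> divides \<open>Q s ^ n\<close>.\<close>
      have "(\<exists>a. poly (P s) a = 0 \<and> poly (Q s) a \<noteq> 0) \<longleftrightarrow> \<not> R s = 0"
        if s: "coeff (P s) n \<noteq> 0" for s
      proof -
        obtain c T where c: "c \<noteq> 0" "smult c (Q s ^ n) = P s * T + R s" using R(2)[OF s] by blast
        have deg: "degree (P s) = n"
          using s P Suc by (intro antisym degree_le le_degree) (auto simp: poly_family_def)
        have dR: "coeff (R s) i = 0" if "n \<le> i" for i using R(1) that by (auto simp: poly_family_def)
        have "P s dvd Q s ^ n \<longleftrightarrow> R s = 0"
        proof
          assume "P s dvd Q s ^ n"
          then have "P s dvd R s"
            using c(2) by (metis dvd_add_right_iff dvd_smult dvd_triv_left)
          show "R s = 0"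
          proof (rule ccontr)
            assume "R s \<noteq> 0"
            then have "n \<le> degree (R s)"
              using dvd_imp_degree_le[OF \<open>P s dvd R s\<close>] deg by simp
            then show False using dR \<open>R s \<noteq> 0\<close> leading_coeff_0_iff by blast
          qed
        next
          assume "R s = 0"
          then show "P s dvd Q s ^ n"
            using c by (metis add.right_neutral dvd_smult_cancel dvd_triv_left)
        qed
        moreover have "P s dvd Q s ^ n \<longleftrightarrow> (\<forall>a. poly (P s) a = 0 \<longrightarrow> poly (Q s) a = 0)"
        proof
          assume d: "P s dvd Q s ^ n"
          show "\<forall>a. poly (P s) a = 0 \<longrightarrow> poly (Q s) a = 0"
          proof (intro allI impI)
            fix a assume "poly (P s) a = 0"
            then have "poly (Q s ^ n) a = 0" using d by (metis dvdE mult_zero_left poly_mult)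
            then show "poly (Q s) a = 0" by (simp add: poly_power)
          qed
        next
          assume "\<forall>a. poly (P s) a = 0 \<longrightarrow> poly (Q s) a = 0"
          then show "P s dvd Q s ^ n"
            using s deg by (intro dvd_power_if_roots) auto
        qed
        ultimately show ?thesis by auto
      qed
      then have "(\<exists>a. (\<forall>(m, P)\<in>set xs. poly (P s) a = 0) \<and> poly (Q s) a \<noteq> 0) \<longleftrightarrow>
        coeff (P s) n = 0 \<and> (\<exists>a. poly (?T s) a = 0 \<and> poly (Q s) a \<noteq> 0)
           \<or> \<not> coeff (P s) n = 0 \<and> \<not> R s = 0" for s
        using 2 by (cases "coeff (P s) n = 0") simp_all
      then show ?thesis
        using constructible_disj[OF constructible_conj[OF c0 c1] constructible_conj[OF constructible_not[OF c0] constructible_not[OF constructible_poly_family_zero[OF R(1)]]]]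
        by simp
    qed
  next
    case (3 m P m' P' ys)
    let ?E = "\<lambda>xs s. \<exists>a. (\<forall>(m, P)\<in>set xs. poly (P s) a = 0) \<and> poly (Q s) a \<noteq> 0"
    \<comment> \<open>The equation with the larger bound is reduced modulo the other one. The order
      \<open>m \<le> m'\<close> makes the remainder bound \<open>n\<close> smaller than
      \<open>m'\<close>; the names are generalized so that the two equations can be swapped
      afterwards.\<close>
    have step: "constructible (?E ((m, P) # (m', P') # ys))"
      if le: "m \<le> m'" and P: "P \<in> poly_family m" and P': "P' \<in> poly_family m'"
        and ys: "\<And>n R. (n, R) \<in> set ys \<Longrightarrow> R \<in> poly_family n"
        and sum: "(\<Sum>(m, P)\<leftarrow>xs. Suc m) = Suc m + (Suc m' + (\<Sum>(m, P)\<leftarrow>ys. Suc m))" for m P m' P'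
    proof (cases m)
      case 0
      have "constructible (?E ((m', P') # ys))"
        by (rule less.hyps) (use P' ys sum in auto)
      then show ?thesis using poly_family_0[of P] P 0 by simp
    next
      case (Suc n)
      let ?T = "\<lambda>s. P s - monom (coeff (P s) n) n"
      have T: "?T \<in> poly_family n" using poly_family_truncate P Suc by blast
      obtain R where R: "R \<in> poly_family n" "\<And>s. coeff (P s) n \<noteq> 0 \<Longrightarrow>
        \<exists>c T. c \<noteq> 0 \<and> smult c (P' s) = P s * T + R s"
        using poly_family_pseudo_rem[OF P[unfolded Suc] P'] by blast
      have c0: "constructible (\<lambda>s. coeff (P s) n = 0)"
        using P by (intro constructible_zero) (auto simp: poly_family_def)
      have c1: "constructible (?E ((n, ?T) # (m', P') # ys))"
        by (rule less.hyps) (use P' ys sum T Suc in auto)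
      have c2: "constructible (?E ((m, P) # (n, R) # ys))"
        by (rule less.hyps) (use P R(1) le ys sum Suc in auto)
      have "?E ((m, P) # (m', P') # ys) s = ?E ((m, P) # (n, R) # ys) s"
        if s: "coeff (P s) n \<noteq> 0" for s
      proof -
        obtain c T where c: "c \<noteq> 0" "smult c (P' s) = P s * T + R s" using R(2)[OF s] by blast
        have "c * poly (P' s) a = poly (P s) a * poly T a + poly (R s) a" for a
          using arg_cong[OF c(2), of "\<lambda>p. poly p a"] by simp
        then have "poly (P s) a = 0 \<Longrightarrow> poly (P' s) a = 0 \<longleftrightarrow> poly (R s) a = 0" for a
          using c(1) by (metis add_0 mult_eq_0_iff)
        then show ?thesis by auto
      qed
      then have "?E ((m, P) # (m', P') # ys) s \<longleftrightarrow>
        coeff (P s) n = 0 \<and> ?E ((n, ?T) # (m', P') # ys) s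
           \<or> \<not> coeff (P s) n = 0 \<and> ?E ((m, P) # (n, R) # ys) s" for s
        by (cases "coeff (P s) n = 0") simp_all
      then show ?thesis
        using constructible_disj[OF constructible_conj[OF c0 c1] constructible_conj[OF constructible_not[OF c0] c2]] by simp
    qed
    show ?thesis
    proof (cases "m \<le> m'")
      case True
      then show ?thesis unfolding 3 by (intro step) (use less.prems 3 in auto)
    next
      case False
      have "constructible (?E ((m', P') # (m, P) # ys))"
        by (intro step) (use less.prems 3 False in auto)
      then show ?thesis unfolding 3 by (simp add: conj_ac)
    qed
  qed
qed

text \<open>An existential quantifier passes through a disjunction but not through a conjunction,
  hence this normal form. One inequation per disjunct suffices, since several of them merge into
  their product.\<close>

definition dnf :: "(('v \<Rightarrow> 'f::comm_ring_1) \<Rightarrow> bool) \<Rightarrow> bool" where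
  "dnf \<phi> \<longleftrightarrow> (\<exists>D. (\<forall>(A, q)\<in>set D. set A \<subseteq> polynomial_fun \<and> q \<in> polynomial_fun) \<and>
     (\<forall>s. \<phi> s \<longleftrightarrow> (\<exists>(A, q)\<in>set D. (\<forall>p\<in>set A. p s = 0) \<and> q s \<noteq> 0)))"

lemma dnf_disj:
  assumes "dnf \<phi>" "dnf \<psi>"
  shows "dnf (\<lambda>s. \<phi> s \<or> \<psi> s)"
proof -
  obtain D where D: "\<forall>(A, q)\<in>set D. set A \<subseteq> polynomial_fun \<and> q \<in> polynomial_fun"
    "\<forall>s. \<phi> s \<longleftrightarrow> (\<exists>(A, q)\<in>set D. (\<forall>p\<in>set A. p s = 0) \<and> q s \<noteq> 0)"
    using assms(1) unfolding dnf_def by blast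
  obtain D' where D': "\<forall>(A, q)\<in>set D'. set A \<subseteq> polynomial_fun \<and> q \<in> polynomial_fun"
    "\<forall>s. \<psi> s \<longleftrightarrow> (\<exists>(A, q)\<in>set D'. (\<forall>p\<in>set A. p s = 0) \<and> q s \<noteq> 0)"
    using assms(2) unfolding dnf_def by blast
  show ?thesis
    unfolding dnf_def using D D' by (intro exI[of _ "D @ D'"]) (simp add: ball_Un bex_Un)
qed

lemma dnf_conj:
  fixes \<phi> :: "('v \<Rightarrow> 'f::idom) \<Rightarrow> bool"
  assumes "dnf \<phi>" "dnf \<psi>"
  shows "dnf (\<lambda>s. \<phi> s \<and> \<psi> s)"
proof -
  obtain D where D: "\<forall>(A, q)\<in>set D. set A \<subseteq> polynomial_fun \<and> q \<in> polynomial_fun"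
    "\<forall>s. \<phi> s \<longleftrightarrow> (\<exists>(A, q)\<in>set D. (\<forall>p\<in>set A. p s = 0) \<and> q s \<noteq> 0)"
    using assms(1) unfolding dnf_def by blast
  obtain D' where D': "\<forall>(A, q)\<in>set D'. set A \<subseteq> polynomial_fun \<and> q \<in> polynomial_fun"
    "\<forall>s. \<psi> s \<longleftrightarrow> (\<exists>(A, q)\<in>set D'. (\<forall>p\<in>set A. p s = 0) \<and> q s \<noteq> 0)"
    using assms(2) unfolding dnf_def by blast
  define E where "E = map (\<lambda>((A, q), (A', q')). (A @ A', \<lambda>s. q s * q' s)) (List.product D D')"
  show ?thesis
    unfolding dnf_def
  proof (intro exI[of _ E] conjI allI)
    show "\<forall>(A, q)\<in>set E. set A \<subseteq> polynomial_fun \<and> q \<in> polynomial_fun"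
      using D(1) D'(1) by (fastforce simp: E_def intro: polynomial_fun_mult)
    fix s
    have "(\<exists>(A, q)\<in>set E. (\<forall>p\<in>set A. p s = 0) \<and> q s \<noteq> 0) \<longleftrightarrow>
      (\<exists>(A, q)\<in>set D. \<exists>(A', q')\<in>set D'. (\<forall>p\<in>set (A @ A'). p s = 0) \<and> q s * q' s \<noteq> 0)"
      by (simp add: E_def case_prod_unfold)
    also have "\<dots> \<longleftrightarrow> \<phi> s \<and> \<psi> s"
      using D(2) D'(2) by (simp add: ball_Un case_prod_unfold) blast
    finally show "(\<phi> s \<and> \<psi> s) \<longleftrightarrow> (\<exists>(A, q)\<in>set E. (\<forall>p\<in>set A. p s = 0) \<and> q s \<noteq> 0)" by simp
  qed
qed

text \<open>Carrying the negation along makes the case of \<open>constructible_not\<close> a mere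
  exchange.\<close>

lemma constructible_imp_dnf:
  fixes \<phi> :: "('v \<Rightarrow> 'f::idom) \<Rightarrow> bool"
  assumes "constructible \<phi>"
  shows "dnf \<phi> \<and> dnf (\<lambda>s. \<not> \<phi> s)"
  using assms
proof (induction rule: constructible.induct)
  case (constructible_zero p)
  have "dnf (\<lambda>s. p s = 0)"
    unfolding dnf_def
    by (rule exI[of _ "[([p], \<lambda>s. 1)]"]) (use constructible_zero in \<open>auto intro: polynomial_fun_const\<close>)
  moreover have "dnf (\<lambda>s. \<not> p s = 0)"
    unfolding dnf_def by (rule exI[of _ "[([], p)]"]) (use constructible_zero in auto)
  ultimately show ?case by simp
next
  case (constructible_not \<phi>)
  then show ?case by simp
next
  case (constructible_conj \<phi> \<psi>)
  then show ?case
    using dnf_conj[of \<phi> \<psi>] dnf_disj[of "\<lambda>s. \<not> \<phi> s" "\<lambda>s. \<not> \<psi> s"] by simp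
qed

text \<open>In each disjunct of the normal form the polynomials are expanded in the coordinate
  \<open>n\<close>; what remains is the existence of a common root of some of them that is not a
  root of another one.\<close>

lemma constructible_ex_upd:
  fixes \<phi> :: "('v \<Rightarrow> 'f::alg_closed_field) \<Rightarrow> bool"
  assumes "constructible \<phi>"
  shows "constructible (\<lambda>s. \<exists>a. \<phi> (s(n := a)))"
proof -
  obtain D where D: "\<forall>(A, q)\<in>set D. set A \<subseteq> polynomial_fun \<and> q \<in> polynomial_fun"
    "\<forall>s. \<phi> s \<longleftrightarrow> (\<exists>(A, q)\<in>set D. (\<forall>p\<in>set A. p s = 0) \<and> q s \<noteq> 0)"
    using conjunct1[OF constructible_imp_dnf[OF assms]] unfolding dnf_def by blast
  have "\<forall>p\<in>polynomial_fun. \<exists>mP. snd mP \<in> poly_family (fst mP) \<and> (\<forall>s a. poly (snd mP s) a = p (s(n := a)))"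
    using poly_family_expand[where n=n] by fastforce
  then obtain F where F: "\<forall>p\<in>polynomial_fun. snd (F p) \<in> poly_family (fst (F p)) \<and>
      (\<forall>s a. poly (snd (F p) s) a = p (s(n := a :: 'f)))"
    by (rule bchoice[THEN exE])
  have *: "constructible (\<lambda>s. \<exists>a. (\<forall>p\<in>set A. p (s(n := a)) = 0) \<and> q (s(n := a)) \<noteq> 0)"
    if "(A, q) \<in> set D" for A q
  proof -
    have A: "set A \<subseteq> polynomial_fun" and q: "q \<in> polynomial_fun" using D(1) that by auto
    have "constructible (\<lambda>s. \<exists>a. (\<forall>(m, P)\<in>set (map F A). poly (P s) a = 0) \<and> poly (snd (F q) s) a \<noteq> 0)"
    proof (rule constructible_ex_root)
      show "snd (F q) \<in> poly_family (fst (F q))" using F q by blast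
      fix m P assume "(m, P) \<in> set (map F A)"
      then obtain p where "p \<in> set A" "F p = (m, P)" by auto
      then show "P \<in> poly_family m" using F A by (metis fst_conv snd_conv subsetD)
    qed
    moreover have "(\<forall>(m, P)\<in>set (map F A). poly (P s) a = 0) \<longleftrightarrow> (\<forall>p\<in>set A. p (s(n := a)) = 0)" for s a
    proof -
      have "poly (snd (F p) s) a = p (s(n := a))" if "p \<in> set A" for p using F A that by blast
      then show ?thesis by (simp add: case_prod_unfold del: fun_upd_apply)
    qed
    moreover have "poly (snd (F q) s) a = q (s(n := a))" for s a using F q by blast
    ultimately show ?thesis by simp
  qed
  have "constructible (\<lambda>s. \<exists>i\<in>set D. \<exists>a. (\<forall>p\<in>set (fst i). p (s(n := a)) = 0) \<and> snd i (s(n := a)) \<noteq> 0)"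
    using * by (intro constructible_bex) auto
  moreover have "(\<exists>i\<in>set D. \<exists>a. (\<forall>p\<in>set (fst i). p (s(n := a)) = 0) \<and> snd i (s(n := a)) \<noteq> 0)
      \<longleftrightarrow> (\<exists>a. \<phi> (s(n := a)))" for s
    using D(2) by (auto simp: case_prod_unfold simp del: fun_upd_apply)
  ultimately show ?thesis by simp
qed

lemma constructible_ex:
  fixes \<phi> :: "('v \<Rightarrow> 'f::alg_closed_field) \<Rightarrow> ('b::finite \<Rightarrow> 'f) \<Rightarrow> bool"
  assumes "constructible (\<lambda>r. \<phi> (r \<circ> Inl) (r \<circ> Inr))"
  shows "constructible (\<lambda>s. \<exists>t. \<phi> s t)"
proof -
  \<comment> \<open>Coordinates in \<open>B\<close> are already bound, while the remaining ones are
    still read from the right summand; the induction binds one more at a time.\<close>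
  have *: "constructible (\<lambda>r. \<exists>t. \<phi> (r \<circ> Inl) (\<lambda>b. if b \<in> B then t b else r (Inr b)))" if "finite B" for B
    using that
  proof (induction B rule: finite_induct)
    case empty
    then show ?case using assms by (simp add: comp_def)
  next
    case (insert b B)
    have "constructible (\<lambda>r. \<exists>a t. \<phi> ((r(Inr b := a)) \<circ> Inl) (\<lambda>x. if x \<in> B then t x else (r(Inr b := a)) (Inr x)))"
      by (rule constructible_ex_upd[OF insert.IH])
    moreover have "(\<exists>a t. \<phi> ((r(Inr b := a)) \<circ> Inl) (\<lambda>x. if x \<in> B then t x else (r(Inr b := a)) (Inr x)))
       \<longleftrightarrow> (\<exists>t. \<phi> (r \<circ> Inl) (\<lambda>x. if x \<in> insert b B then t x else r (Inr x)))" (is "?L \<longleftrightarrow> ?R") for r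
    proof
      assume ?L
      then obtain a t where at: "\<phi> ((r(Inr b := a)) \<circ> Inl) (\<lambda>x. if x \<in> B then t x else (r(Inr b := a)) (Inr x))"
        by (elim exE)
      have eq1: "(r(Inr b := a)) \<circ> Inl = r \<circ> Inl" by auto
      have eq2: "(\<lambda>x. if x \<in> B then t x else (r(Inr b := a)) (Inr x))
        = (\<lambda>x. if x \<in> insert b B then (t(b := a)) x else r (Inr x))"
        using insert.hyps by (intro ext) auto
      show ?R by (rule exI[of _ "t(b := a)"]) (rule at[unfolded eq1 eq2])
    next
      assume ?R
      then obtain t where t: "\<phi> (r \<circ> Inl) (\<lambda>x. if x \<in> insert b B then t x else r (Inr x))" ..
      have eq1: "(r(Inr b := t b)) \<circ> Inl = r \<circ> Inl" by auto
      have eq2: "(\<lambda>x. if x \<in> B then t x else (r(Inr b := t b)) (Inr x))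
        = (\<lambda>x. if x \<in> insert b B then t x else r (Inr x))"
        by auto
      show ?L by (rule exI[of _ "t b"], rule exI[of _ t]) (rule t[folded eq1 eq2])
    qed
    ultimately show ?case by (simp only:)
  qed
  \<comment> \<open>All right coordinates are bound by now, so they may be filled with the default
    value 0.\<close>
  have sub: "(\<lambda>s. case_sum s (\<lambda>_. 0) v) \<in> (polynomial_fun :: (('v \<Rightarrow> 'f) \<Rightarrow> 'f) set)" for v :: "'v + 'b"
    by (cases v) (auto intro: polynomial_fun_const polynomial_fun_var)
  show ?thesis
    using constructible_subst[OF *[OF finite_UNIV], of "\<lambda>s. case_sum s (\<lambda>_. 0)", OF sub] by (simp add: comp_def)
qed

lemma constructible_all:
  fixes \<phi> :: "('v \<Rightarrow> 'f::alg_closed_field) \<Rightarrow> ('b::finite \<Rightarrow> 'f) \<Rightarrow> bool"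
  assumes "constructible (\<lambda>r. \<phi> (r \<circ> Inl) (r \<circ> Inr))"
  shows "constructible (\<lambda>s. \<forall>t. \<phi> s t)"
proof -
  have "constructible (\<lambda>s. \<exists>t. \<not> \<phi> s t)"
    by (rule constructible_ex) (rule constructible_not[OF assms])
  from constructible_not[OF this] show ?thesis by simp
qed

section \<open>Generic conditions\<close>

definition generically :: "(('v \<Rightarrow> 'f::comm_ring_1) \<Rightarrow> bool) \<Rightarrow> bool" where
  "generically \<phi> \<longleftrightarrow> (\<exists>p\<in>polynomial_fun. (\<exists>s. p s \<noteq> 0) \<and> (\<forall>s. p s \<noteq> 0 \<longrightarrow> \<phi> s))"

lemma generically_mono: "generically \<phi> \<Longrightarrow> (\<And>s. \<phi> s \<Longrightarrow> \<psi> s) \<Longrightarrow> generically \<psi>"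
  unfolding generically_def by blast

lemma generically_ex: "generically \<phi> \<Longrightarrow> \<exists>s. \<phi> s"
  unfolding generically_def by blast

lemma generically_all: "(\<And>s. \<phi> s) \<Longrightarrow> generically (\<phi> :: ('v \<Rightarrow> 'f::comm_ring_1) \<Rightarrow> bool)"
  unfolding generically_def using polynomial_fun_const[of 1] by force

lemma polynomial_fun_on_line:
  assumes "p \<in> polynomial_fun"
  shows "\<exists>P. \<forall>a. p (\<lambda>v. s v + a * (t v - s v)) = poly P a"
  using assms
proof (induction rule: polynomial_fun.induct)
  case (polynomial_fun_const c)
  show ?case by (rule exI[of _ "[:c:]"]) simp
next
  case (polynomial_fun_var v)
  show ?case by (rule exI[of _ "[:s v, t v - s v:]"]) simp
next
  case (polynomial_fun_add p q)
  then obtain P Q where "\<forall>a. p (\<lambda>v. s v + a * (t v - s v)) = poly P a"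
    "\<forall>a. q (\<lambda>v. s v + a * (t v - s v)) = poly Q a" by blast
  then show ?case by (intro exI[of _ "P + Q"]) simp
next
  case (polynomial_fun_mult p q)
  then obtain P Q where "\<forall>a. p (\<lambda>v. s v + a * (t v - s v)) = poly P a"
    "\<forall>a. q (\<lambda>v. s v + a * (t v - s v)) = poly Q a" by blast
  then show ?case by (intro exI[of _ "P * Q"]) simp
qed

text \<open>Irreducibility of affine space. On the line through a point where \<open>p\<close> is
  nonzero and a point where \<open>q\<close> is nonzero, both restrict to nonzero polynomials in one
  variable (parameters 0 and 1 witness this), and over an infinite field their product has a
  nonroot.\<close>

lemma generically_conj:
  fixes \<phi> :: "('v \<Rightarrow> 'f::alg_closed_field) \<Rightarrow> bool"
  assumes "generically \<phi>" "generically \<psi>"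
  shows "generically (\<lambda>s. \<phi> s \<and> \<psi> s)"
proof -
  obtain p s where p: "p \<in> polynomial_fun" "p s \<noteq> 0" "\<And>s. p s \<noteq> 0 \<Longrightarrow> \<phi> s"
    using assms(1) unfolding generically_def by blast
  obtain q t where q: "q \<in> polynomial_fun" "q t \<noteq> 0" "\<And>s. q s \<noteq> 0 \<Longrightarrow> \<psi> s"
    using assms(2) unfolding generically_def by blast
  obtain P where P: "\<And>a. p (\<lambda>v. s v + a * (t v - s v)) = poly P a"
    using polynomial_fun_on_line[OF p(1)] by blast
  obtain Q where Q: "\<And>a. q (\<lambda>v. s v + a * (t v - s v)) = poly Q a"
    using polynomial_fun_on_line[OF q(1)] by blast
  have "P \<noteq> 0" using P[of 0] p(2) by auto
  moreover have "Q \<noteq> 0" using Q[of 1] q(2) by auto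
  ultimately obtain a where "poly (P * Q) a \<noteq> 0"
    using poly_nonroot_exists[of "P * Q"] by auto
  then have "p (\<lambda>v. s v + a * (t v - s v)) * q (\<lambda>v. s v + a * (t v - s v)) \<noteq> 0"
    using P Q by simp
  then show ?thesis
    unfolding generically_def
    by (intro bexI[OF _ polynomial_fun_mult[OF p(1) q(1)]]) (use p(3) q(3) in auto)
qed

lemma generically_ball:
  fixes \<phi> :: "'i \<Rightarrow> ('v \<Rightarrow> 'f::alg_closed_field) \<Rightarrow> bool"
  assumes "finite I" "\<And>i. i \<in> I \<Longrightarrow> generically (\<phi> i)"
  shows "generically (\<lambda>s. \<forall>i\<in>I. \<phi> i s)"
  using assms
proof (induction I rule: finite_induct)
  case empty
  then show ?case by (simp add: generically_all)
next
  case (insert i I)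
  then show ?case using generically_conj[of "\<phi> i" "\<lambda>s. \<forall>i\<in>I. \<phi> i s"] by simp
qed

text \<open>On constructible conditions, \<open>generically\<close> behaves like an ultrafilter.\<close>

lemma generically_cases:
  fixes \<phi> :: "('v \<Rightarrow> 'f::alg_closed_field) \<Rightarrow> bool"
  assumes "constructible \<phi>"
  shows "generically \<phi> \<or> generically (\<lambda>s. \<not> \<phi> s)"
  using assms
proof (induction rule: constructible.induct)
  case (constructible_zero p)
  show ?case
  proof (cases "\<exists>s. p s \<noteq> 0")
    case True
    then have "generically (\<lambda>s. \<not> p s = 0)" using constructible_zero unfolding generically_def by blast
    then show ?thesis ..
  next
    case False
    then have "generically (\<lambda>s. p s = 0)" by (intro generically_all) simp
    then show ?thesis ..
  qed
next
  case (constructible_not \<phi>)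
  then show ?case by auto
next
  case (constructible_conj \<phi> \<psi>)
  then show ?case
    using generically_conj[of \<phi> \<psi>] generically_mono[of "\<lambda>s. \<not> \<phi> s" "\<lambda>s. \<not> (\<phi> s \<and> \<psi> s)"]
      generically_mono[of "\<lambda>s. \<not> \<psi> s" "\<lambda>s. \<not> (\<phi> s \<and> \<psi> s)"] by blast
qed

lemma generically_subst:
  assumes "generically \<phi>" "\<And>v. (\<lambda>s. f s v) \<in> polynomial_fun" "surj f"
  shows "generically (\<lambda>s. \<phi> (f s))"
proof -
  obtain p where p: "p \<in> polynomial_fun" "\<exists>s. p s \<noteq> 0" "\<forall>s. p s \<noteq> 0 \<longrightarrow> \<phi> s"
    using assms(1) unfolding generically_def by blast
  then have "\<exists>s. p (f s) \<noteq> 0" using assms(3) by (metis surjD)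
  then show ?thesis
    unfolding generically_def
    by (intro bexI[OF _ polynomial_fun_subst[OF p(1) assms(2)]]) (use p(3) in auto)
qed

text \<open>The finite range turns comparisons and arithmetic into finite Boolean combinations. It
  also forces a generic value: otherwise finitely many generic conditions would yield a point at
  which no value is taken.\<close>

definition definable_int :: "(('v \<Rightarrow> 'f::comm_ring_1) \<Rightarrow> int) \<Rightarrow> bool" where
  "definable_int f \<longleftrightarrow> finite (range f) \<and> (\<forall>m. constructible (\<lambda>s. f s = m))"

lemma constructible_definable_int2:
  assumes "definable_int f" "definable_int g"
  shows "constructible (\<lambda>s. R (f s) (g s))"
proof -
  have "constructible (\<lambda>s. \<exists>i\<in>range f. \<exists>j\<in>range g. R i j \<and> f s = i \<and> g s = j)"
    using assms unfolding definable_int_def by (intro constructible_bex constructible_conj constructible_const) auto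
  moreover have "(\<exists>i\<in>range f. \<exists>j\<in>range g. R i j \<and> f s = i \<and> g s = j) \<longleftrightarrow> R (f s) (g s)" for s
    by auto
  ultimately show ?thesis by simp
qed

lemma definable_int2:
  assumes "definable_int f" "definable_int g"
  shows "definable_int (\<lambda>s. h (f s) (g s))"
  unfolding definable_int_def
proof
  have "range (\<lambda>s. h (f s) (g s)) \<subseteq> (\<lambda>(i, j). h i j) ` (range f \<times> range g)" by auto
  then show "finite (range (\<lambda>s. h (f s) (g s)))"
    using assms unfolding definable_int_def by (meson finite_SigmaI finite_imageI finite_subset)
  show "\<forall>m. constructible (\<lambda>s. h (f s) (g s) = m)"
    using constructible_definable_int2[OF assms, of "\<lambda>i j. h i j = _"] by blast
qed

lemma definable_int_of_bool: "constructible \<phi> \<Longrightarrow> definable_int (\<lambda>s. of_bool (\<phi> s))"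
proof -
  assume \<phi>: "constructible \<phi>"
  have "range (\<lambda>s. of_bool (\<phi> s) :: int) \<subseteq> {0, 1}" by auto
  then have fin: "finite (range (\<lambda>s. of_bool (\<phi> s) :: int))" by (rule finite_subset) simp
  have "constructible (\<lambda>s. of_bool (\<phi> s) = m)" for m :: int
  proof -
    have "constructible (\<lambda>s. \<phi> s \<and> m = 1 \<or> \<not> \<phi> s \<and> m = 0)"
      by (intro constructible_disj constructible_conj constructible_not constructible_const \<phi>)
    moreover have "(\<phi> s \<and> m = 1 \<or> \<not> \<phi> s \<and> m = 0) \<longleftrightarrow> of_bool (\<phi> s) = m" for s by auto
    ultimately show ?thesis by simp
  qed
  with fin show ?thesis by (simp add: definable_int_def)
qed

lemma definable_int_const: "definable_int (\<lambda>s. c)"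
  by (simp add: definable_int_def constructible_const)

lemma definable_int_sum: "(\<And>i. i \<in> I \<Longrightarrow> definable_int (f i)) \<Longrightarrow> definable_int (\<lambda>s. \<Sum>i\<in>I. f i s)"
proof (induction I rule: infinite_finite_induct)
  case (insert i I)
  then show ?case using definable_int2[of "f i" "\<lambda>s. \<Sum>i\<in>I. f i s" "(+)"] by simp
qed (simp_all add: definable_int_const)

lemma definable_int_subst:
  assumes "definable_int f" "\<And>v. (\<lambda>s. g s v) \<in> polynomial_fun"
  shows "definable_int (\<lambda>s. f (g s))"
  unfolding definable_int_def
proof
  show "finite (range (\<lambda>s. f (g s)))"
    using assms(1) unfolding definable_int_def by (rule conjE) (erule finite_subset[rotated], auto)
  have "constructible (\<lambda>s. f (g s) = m)" for m
    using assms(1) by (intro constructible_subst[OF _ assms(2), of "\<lambda>s. f s = m"]) (simp add: definable_int_def)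
  then show "\<forall>m. constructible (\<lambda>s. f (g s) = m)" ..
qed

lemma definable_int_generic_value:
  fixes f :: "('v \<Rightarrow> 'f::alg_closed_field) \<Rightarrow> int"
  assumes "definable_int f"
  shows "\<exists>m. generically (\<lambda>s. f s = m)"
proof (rule ccontr)
  assume "\<not> ?thesis"
  then have "generically (\<lambda>s. f s \<noteq> m)" for m
    using generically_cases[of "\<lambda>s. f s = m"] assms unfolding definable_int_def by blast
  then have "generically (\<lambda>s. \<forall>m\<in>range f. f s \<noteq> m)"
    using assms unfolding definable_int_def by (intro generically_ball) auto
  then show False using generically_ex by fastforce
qed

section \<open>Leading positions and dimension\<close>

interpretation fs: vector_space "fscale :: 'f::field \<Rightarrow> ('a \<Rightarrow> 'f) \<Rightarrow> 'a \<Rightarrow> 'f"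
  by unfold_locales (auto simp: fscale_def fun_eq_iff algebra_simps)

lemma sum_fun_apply: "(\<Sum>i\<in>I. f i) x = (\<Sum>i\<in>I. f i x)"
  by (induction I rule: infinite_finite_induct) auto

lemma fsubspace_iff:
  "fsubspace S \<longleftrightarrow> (\<lambda>_. 0) \<in> S \<and> (\<forall>a\<in>S. \<forall>b\<in>S. (\<lambda>x. a x + b x) \<in> S) \<and> (\<forall>c. \<forall>a\<in>S. (\<lambda>x. c * a x) \<in> S)"
  by (auto simp: fsubspace_def fs.subspace_def fscale_def zero_fun_def plus_fun_def)

lemma fsubspace_Int: "fsubspace S \<Longrightarrow> fsubspace T \<Longrightarrow> fsubspace (S \<inter> T)"
  by (simp add: fsubspace_iff)

text \<open>The dimension of a subspace is its number of leading positions. This makes the dimension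
  of a constructible family of subspaces constructible, and bounds dimensions coordinate by coordinate.\<close>

definition leading :: "('a \<Rightarrow> nat) \<Rightarrow> ('a \<Rightarrow> 'f::zero) set \<Rightarrow> 'a set" where
  "leading r S = {x. \<exists>a\<in>S. a x \<noteq> 0 \<and> (\<forall>y. r x < r y \<longrightarrow> a y = 0)}"

text \<open>Vectors with distinct leading positions form an echelon system. Triangularity gives
  independence, and subtracting a multiple of the vector led by the top position of \<open>a\<close>
  lowers that position. Ranks need to be distinct only on \<open>J\<close>, since vectors of
  \<open>S\<close> vanish elsewhere.\<close>

lemma leading_basis:
  fixes S :: "('a \<Rightarrow> 'f::field) set"
  assumes S: "fsubspace S" and J: "finite J" "inj_on r J" and SJ: "S \<subseteq> {a. \<forall>x. x \<notin> J \<longrightarrow> a x = 0}"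
  shows "\<exists>A. (\<forall>x\<in>leading r S. A x \<in> S) \<and> inj_on A (leading r S) \<and>
    fs.independent (A ` leading r S) \<and> S \<subseteq> fs.span (A ` leading r S)"
proof -
  have J3: "a x = 0" if "a \<in> S" "x \<notin> J" for a x using SJ that by auto
  have sub: "leading r S \<subseteq> J" using J3 by (auto simp: leading_def)
  then have fin: "finite (leading r S)" using J(1) finite_subset by blast
  have "\<forall>x\<in>leading r S. \<exists>a. a \<in> S \<and> a x \<noteq> 0 \<and> (\<forall>y. r x < r y \<longrightarrow> a y = 0)"
    by (auto simp: leading_def)
  then obtain A where A: "\<forall>x\<in>leading r S. A x \<in> S \<and> A x x \<noteq> 0 \<and> (\<forall>y. r x < r y \<longrightarrow> A x y = 0)"
    by (rule bchoice[THEN exE])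
  have inj: "inj_on A (leading r S)"
  proof (rule inj_onI, rule ccontr)
    fix x y assume xy: "x \<in> leading r S" "y \<in> leading r S" "A x = A y" "x \<noteq> y"
    then have "r x \<noteq> r y" using sub J(2) by (meson inj_onD subsetD)
    then show False using A xy by (metis linorder_neqE_nat)
  qed
  have "fs.independent (A ` leading r S)"
  proof (rule fs.independent_if_scalars_zero)
    show "finite (A ` leading r S)" using fin by simp
    fix f x assume 0: "(\<Sum>v\<in>A ` leading r S. fscale (f v) v) = 0" and "x \<in> A ` leading r S"
    have z: "(\<Sum>x\<in>leading r S. f (A x) * A x y) = 0" for y
    proof -
      have "(\<Sum>v\<in>A ` leading r S. fscale (f v) v) y = (\<Sum>v\<in>A ` leading r S. f v * v y)"
        by (simp add: fscale_def sum_fun_apply)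
      then show ?thesis using 0 inj by (simp add: sum.reindex)
    qed
    have "f (A x) = 0" if "x \<in> leading r S" for x
      using that
    \<comment> \<open>Downwards from the top rank: at position \<open>x\<close>, vectors led by
      lower positions vanish, and those led by higher ones already have coefficient 0.\<close>
    proof (induction "Max (r ` J) - r x" arbitrary: x rule: less_induct)
      case less
      have "f (A y) * A y x = 0" if "y \<in> leading r S" "y \<noteq> x" for y
      proof (cases "r y < r x")
        case True
        then show ?thesis using A that by auto
      next
        case False
        then have "r x < r y" using that less.prems sub J(2) by (metis inj_onD linorder_neqE_nat subsetD)
        moreover have "r y \<le> Max (r ` J)" using that sub J(1) by auto
        ultimately show ?thesis using less.hyps[of y] that by simp
      qed
      then have "(\<Sum>y\<in>leading r S - {x}. f (A y) * A y x) = 0"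
        by (intro sum.neutral) auto
      then have "f (A x) * A x x = (\<Sum>y\<in>leading r S. f (A y) * A y x)"
        using less.prems fin by (simp add: sum.remove[of _ x])
      then show ?case using z A less.prems by auto
    qed
    then show "f x = 0" using \<open>x \<in> A ` leading r S\<close> by auto
  qed
  moreover have "a \<in> fs.span (A ` leading r S)" if "a \<in> S" "\<forall>y. m \<le> r y \<longrightarrow> a y = 0" for a m
    using that
  proof (induction m arbitrary: a)
    case 0
    then have "a = 0" by (auto simp: fun_eq_iff)
    then show ?case by (simp only: fs.span_zero)
  next
    case (Suc m)
    show ?case
    proof (cases "\<exists>y. r y = m \<and> a y \<noteq> 0")
      case False
      then show ?thesis using Suc.prems by (intro Suc.IH) (auto simp: Suc_le_eq nat_less_le)
    next
      case True
      then obtain y where y: "r y = m" "a y \<noteq> 0" by blast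
      have yl: "y \<in> leading r S" using y Suc.prems by (auto simp: leading_def Suc_le_eq intro!: bexI[of _ a])
      let ?b = "fscale (a y / A y y) (A y)"
      have bS: "?b \<in> S" using A yl S unfolding fsubspace_def by (intro fs.subspace_scale) auto
      have "a - ?b \<in> fs.span (A ` leading r S)"
      proof (rule Suc.IH)
        show "a - ?b \<in> S" using S Suc.prems(1) bS
          unfolding fsubspace_def by (rule fs.subspace_diff)
        show "\<forall>z. m \<le> r z \<longrightarrow> (a - ?b) z = 0"
        proof (intro allI impI)
          fix z assume "m \<le> r z"
          show "(a - ?b) z = 0"
          proof (cases "z = y")
            case True
            then show ?thesis using A yl by (simp add: fscale_def)
          next
            case False
            show ?thesis
            proof (cases "r z = m")
              case True
              then have "z \<notin> J" using False y(1) yl sub J(2) by (metis inj_onD subsetD)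
              then show ?thesis using J3[OF Suc.prems(1)] J3[OF bS] by simp
            next
              case False
              then have "m < r z" using \<open>m \<le> r z\<close> by simp
              then show ?thesis using A yl y(1) Suc.prems(2) by (simp add: fscale_def Suc_le_eq)
            qed
          qed
        qed
      qed
      moreover have "?b \<in> fs.span (A ` leading r S)"
        using yl by (intro fs.span_scale fs.span_base) auto
      ultimately have "(a - ?b) + ?b \<in> fs.span (A ` leading r S)" by (rule fs.span_add)
      then show ?thesis by simp
    qed
  qed
  moreover have "\<forall>y. Suc (Max (r ` J)) \<le> r y \<longrightarrow> a y = 0" if "a \<in> S" for a
  proof (intro allI impI)
    fix y assume "Suc (Max (r ` J)) \<le> r y"
    then have "y \<notin> J" using J(1) by (metis Max_ge Suc_n_not_le_n finite_imageI imageI le_trans)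
    then show "a y = 0" using J3 that by blast
  qed
  ultimately show ?thesis
    using A inj by (intro exI[of _ A]) blast
qed

lemma fdim_leading:
  fixes S :: "('a \<Rightarrow> 'f::field) set"
  assumes "fsubspace S" "finite J" "inj_on r J" "S \<subseteq> {a. \<forall>x. x \<notin> J \<longrightarrow> a x = 0}"
  shows "fdim S = card (leading r S)"
proof -
  obtain A where A: "\<forall>x\<in>leading r S. A x \<in> S" "inj_on A (leading r S)"
    "fs.independent (A ` leading r S)" "S \<subseteq> fs.span (A ` leading r S)"
    using leading_basis[OF assms] by (elim exE conjE)
  then show ?thesis
    unfolding fdim_def by (intro fs.dim_unique[of "A ` leading r S"]) (auto simp: card_image)
qed

lemma fdim_leading_finite:
  fixes S :: "('a::finite \<Rightarrow> 'f::field) set"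
  assumes "fsubspace S"
  shows "fdim S = card (leading to_nat S)"
  using assms by (intro fdim_leading[of _ UNIV]) auto

interpretation ffs: finite_dimensional_vector_space
  "fscale :: 'f::field \<Rightarrow> ('a::finite \<Rightarrow> 'f) \<Rightarrow> 'a \<Rightarrow> 'f" "range (\<lambda>i j. if j = i then 1 else 0)"
proof
  let ?u = "\<lambda>i (j :: 'a). if j = i then 1 else (0 :: 'f)"
  have inj: "inj (?u :: 'a \<Rightarrow> _)" by (auto simp: inj_on_def fun_eq_iff split: if_splits)
  have sum: "(\<Sum>v\<in>range ?u. fscale (f v) v) x = f (?u x)" for f and x :: 'a
  proof -
    have "(\<Sum>v\<in>range ?u. fscale (f v) v) x = (\<Sum>i\<in>UNIV. fscale (f (?u i)) (?u i) x)"
      using inj by (simp add: sum.reindex sum_fun_apply)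
    also have "\<dots> = (\<Sum>i\<in>UNIV. if i = x then f (?u i) else 0)"
      by (intro sum.cong) (auto simp: fscale_def)
    finally show ?thesis by simp
  qed
  show "finite (range (?u :: 'a \<Rightarrow> _))" by simp
  show "fs.independent (range (?u :: 'a \<Rightarrow> _))"
  proof (rule fs.independent_if_scalars_zero)
    fix f v assume "(\<Sum>v\<in>range ?u. fscale (f v) v) = 0" "v \<in> range (?u :: 'a \<Rightarrow> _)"
    then show "f v = 0" using sum[of f] by auto
  qed simp
  show "fs.span (range (?u :: 'a \<Rightarrow> _)) = UNIV"
  proof (intro equalityI subsetI UNIV_I)
    fix a :: "'a \<Rightarrow> 'f"
    define f where "f v = a (inv ?u v)" for v
    have "f (?u i) = a i" for i using inv_f_f[OF inj] by (simp add: f_def)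
    then have "a = (\<Sum>v\<in>range ?u. fscale (f v) v)" using sum[of f] by (simp add: fun_eq_iff)
    then show "a \<in> fs.span (range ?u)"
      by (metis (no_types, lifting) fs.span_base fs.span_scale fs.span_sum)
  qed
qed

lemma fdim_mono: "S \<subseteq> T \<Longrightarrow> fdim (S :: ('a::finite \<Rightarrow> 'f::field) set) \<le> fdim T"
  unfolding fdim_def by (rule ffs.dim_subset)

lemma fdim_eq_imp_eq:
  fixes S :: "('a::finite \<Rightarrow> 'f::field) set"
  assumes "fsubspace S" "fsubspace T" "S \<subseteq> T" "fdim T \<le> fdim S"
  shows "S = T"
  using assms unfolding fdim_def fsubspace_def by (rule ffs.subspace_dim_equal)

lemma fdim_le_card: "fdim (S :: ('a::finite \<Rightarrow> 'f::field) set) \<le> card (UNIV :: 'a set)"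
  using fdim_mono[of S UNIV] fdim_leading_finite[of "UNIV :: ('a \<Rightarrow> 'f) set"]
    card_mono[of "UNIV :: 'a set" "leading to_nat (UNIV :: ('a \<Rightarrow> 'f) set)"]
  by (simp add: fsubspace_iff)

lemma fdim_zero: "fdim {\<lambda>_ :: 'a::finite. 0 :: 'f::field} = 0"
  by (simp add: fdim_leading_finite fsubspace_iff leading_def)

definition subspace_sum :: "('a \<Rightarrow> 'f::field) set \<Rightarrow> ('a \<Rightarrow> 'f) set \<Rightarrow> ('a \<Rightarrow> 'f) set" where
  "subspace_sum S T = {a + b | a b. a \<in> S \<and> b \<in> T}"

lemma fsubspace_subspace_sum: "fsubspace S \<Longrightarrow> fsubspace T \<Longrightarrow> fsubspace (subspace_sum S T)"
  unfolding fsubspace_def subspace_sum_def by (rule fs.subspace_sums)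

lemma subspace_sum_subset: "fsubspace W \<Longrightarrow> S \<subseteq> W \<Longrightarrow> T \<subseteq> W \<Longrightarrow> subspace_sum S T \<subseteq> W"
  unfolding fsubspace_def subspace_sum_def by (auto intro!: fs.subspace_add)

lemma subset_subspace_sum:
  assumes "fsubspace S" "fsubspace T"
  shows "S \<subseteq> subspace_sum S T" "T \<subseteq> subspace_sum S T"
proof -
  have "0 \<in> S" "0 \<in> T" using assms unfolding fsubspace_def by (auto simp: fs.subspace_0)
  then show "S \<subseteq> subspace_sum S T" "T \<subseteq> subspace_sum S T"
    unfolding subspace_sum_def by (force intro: exI[of _ 0])+
qed

lemma fdim_subspace_sum_Int:
  fixes S :: "('a::finite \<Rightarrow> 'f::field) set"
  assumes "fsubspace S" "fsubspace T"
  shows "fdim (subspace_sum S T) + fdim (S \<inter> T) = fdim S + fdim T"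
  using assms unfolding fdim_def fsubspace_def subspace_sum_def by (rule ffs.dim_sums_Int)

text \<open>Codes a subspace by spanning vectors, so that a quantifier over subspaces becomes a
  quantifier over finitely many coordinates.\<close>

definition combinations :: "('b \<times> 'a \<Rightarrow> 'f::field) \<Rightarrow> ('a::finite \<Rightarrow> 'f) set" where
  "combinations b = {a. \<exists>c. \<forall>x. a x = (\<Sum>j\<in>UNIV. c j * b (j, x))}"

lemma fsubspace_combinations: "fsubspace (combinations b)"
  unfolding fsubspace_iff
proof (intro conjI ballI allI)
  show "(\<lambda>_. 0) \<in> combinations b" by (auto simp: combinations_def intro: exI[of _ "\<lambda>_. 0"])
  fix a assume "a \<in> combinations b"
  then obtain c where c: "\<And>x. a x = (\<Sum>j\<in>UNIV. c j * b (j, x))" by (auto simp: combinations_def)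
  then show "(\<lambda>x. d * a x) \<in> combinations b" for d
    by (auto simp: combinations_def sum_distrib_left mult.assoc intro!: exI[of _ "\<lambda>j. d * c j"])
  fix a' assume "a' \<in> combinations b"
  then obtain c' where "\<And>x. a' x = (\<Sum>j\<in>UNIV. c' j * b (j, x))" by (auto simp: combinations_def)
  with c show "(\<lambda>x. a x + a' x) \<in> combinations b"
    by (auto simp: combinations_def sum.distrib distrib_right intro!: exI[of _ "\<lambda>j. c j + c' j"])
qed

lemma fsubspace_eq_combinations:
  fixes S :: "('a::finite \<Rightarrow> 'f::field) set"
  assumes "fsubspace S"
  shows "\<exists>b :: 'a \<times> 'a \<Rightarrow> 'f. S = combinations b"
proof -
  obtain A where A: "\<forall>x\<in>leading to_nat S. A x \<in> S" "S \<subseteq> fs.span (A ` leading to_nat S)"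
    using leading_basis[OF assms finite_UNIV, of to_nat] by auto
  \<comment> \<open>The echelon basis is indexed by its leading positions and padded with zero
    vectors, so that the same index type \<open>'a\<close> serves all subspaces.\<close>
  define b where "b = (\<lambda>(j, x). if j \<in> leading to_nat S then A j x else 0)"
  have "A j \<in> combinations b" if "j \<in> leading to_nat S" for j
  proof -
    have "A j x = (\<Sum>i\<in>UNIV. (if i = j then 1 else 0) * b (i, x))" for x
      using that by (simp add: b_def if_distrib[of "\<lambda>c. c * _"] cong: if_cong)
    then show ?thesis unfolding combinations_def mem_Collect_eq by (intro exI allI)
  qed
  then have "fs.span (A ` leading to_nat S) \<subseteq> combinations b"
    using fsubspace_combinations[of b] unfolding fsubspace_def by (intro fs.span_minimal) auto
  moreover have "combinations b \<subseteq> S"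
  proof
    fix a assume "a \<in> combinations b"
    then obtain c where c: "\<And>x. a x = (\<Sum>j\<in>UNIV. c j * b (j, x))" by (auto simp: combinations_def)
    have "(\<Sum>j\<in>I. fscale (c j) (\<lambda>x. b (j, x))) \<in> S" for I
    proof -
      have "(\<lambda>x. b (j, x)) \<in> S" for j
        using A(1) assms by (cases "j \<in> leading to_nat S") (auto simp: b_def fsubspace_iff)
      then show ?thesis
        using assms unfolding fsubspace_def by (intro fs.subspace_sum fs.subspace_scale) auto
    qed
    moreover have "a = (\<Sum>j\<in>UNIV. fscale (c j) (\<lambda>x. b (j, x)))"
      using c by (simp add: fun_eq_iff sum_fun_apply fscale_def)
    ultimately show "a \<in> S" by simp
  qed
  ultimately show ?thesis using A(2) by (intro exI[of _ b]) blast
qed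

definition definable_family :: "(('v \<Rightarrow> 'f::comm_ring_1) \<Rightarrow> ('a \<Rightarrow> 'f) set) \<Rightarrow> bool" where
  "definable_family S \<longleftrightarrow> constructible (\<lambda>r. (r \<circ> Inr) \<in> S (r \<circ> Inl))"

lemma constructible_mem:
  assumes "definable_family S" "\<And>v. (\<lambda>s. f s v) \<in> polynomial_fun" "\<And>x. (\<lambda>s. a s x) \<in> polynomial_fun"
  shows "constructible (\<lambda>s. a s \<in> S (f s))"
proof -
  have "(\<lambda>s. case_sum (f s) (a s) v) \<in> polynomial_fun" for v
    using assms(2,3) by (cases v) auto
  from constructible_subst[OF assms(1)[unfolded definable_family_def], of "\<lambda>s. case_sum (f s) (a s)", OF this]
  show ?thesis by (simp add: comp_def)
qed

lemma definable_family_subst: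
  assumes "definable_family S" "\<And>v. (\<lambda>s. f s v) \<in> polynomial_fun"
  shows "definable_family (\<lambda>s. S (f s))"
  unfolding definable_family_def
proof (rule constructible_mem[OF assms(1)])
  fix v
  show "(\<lambda>r. f (r \<circ> Inl) v) \<in> polynomial_fun"
    by (rule polynomial_fun_subst[OF assms(2), of "\<lambda>r. r \<circ> Inl"]) (simp add: polynomial_fun_var)
next
  fix x
  show "(\<lambda>r. (r \<circ> Inr) x) \<in> polynomial_fun" by (simp add: polynomial_fun_var)
qed

lemma definable_family_Int: "definable_family S \<Longrightarrow> definable_family T \<Longrightarrow> definable_family (\<lambda>s. S s \<inter> T s)"
  unfolding definable_family_def Int_iff by (rule constructible_conj)

lemma constructible_subset:
  fixes S T :: "('v \<Rightarrow> 'f::alg_closed_field) \<Rightarrow> ('a::finite \<Rightarrow> 'f) set"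
  assumes "definable_family S" "definable_family T"
  shows "constructible (\<lambda>s. S s \<subseteq> T s)"
proof -
  have "constructible (\<lambda>s. \<forall>a. a \<in> S s \<longrightarrow> a \<in> T s)"
    by (rule constructible_all) (use assms in \<open>auto simp: definable_family_def intro: constructible_imp\<close>)
  then show ?thesis by (simp add: subset_iff)
qed

lemma definable_family_supp: "definable_family (\<lambda>s. {a :: 'a::finite \<Rightarrow> 'f::comm_ring_1. \<forall>x. x \<notin> A \<longrightarrow> a x = 0})"
proof -
  have "constructible (\<lambda>r. \<forall>x\<in>-A. r (Inr x) = (0 :: 'f))"
    by (intro constructible_ball constructible_zero polynomial_fun_var) auto
  then show ?thesis by (simp add: definable_family_def Ball_def)
qed

lemma definable_family_combinations: "definable_family (\<lambda>b :: 'b::finite \<times> 'a::finite \<Rightarrow> 'f::alg_closed_field. combinations b)"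
proof -
  have "constructible (\<lambda>r :: ('b \<times> 'a) + 'a \<Rightarrow> 'f. \<exists>c. \<forall>x\<in>UNIV. r (Inr x) = (\<Sum>j\<in>UNIV. c j * r (Inl (j, x))))"
    by (rule constructible_ex, rule constructible_ball, simp, rule constructible_eq)
      (simp_all add: polynomial_fun_var polynomial_fun_sum polynomial_fun_mult)
  then show ?thesis by (simp add: definable_family_def combinations_def)
qed

lemma definable_int_fdim:
  fixes S :: "('v \<Rightarrow> 'f::alg_closed_field) \<Rightarrow> ('a::finite \<Rightarrow> 'f) set"
  assumes "definable_family S" "\<And>s. fsubspace (S s)"
  shows "definable_int (\<lambda>s. int (fdim (S s)))"
proof -
  have "constructible (\<lambda>s. \<exists>a. a \<in> S s \<and> a x \<noteq> 0 \<and> (\<forall>y\<in>{y. to_nat x < to_nat y}. a y = 0))" for x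
    using assms(1) unfolding definable_family_def
    by (intro constructible_ex constructible_conj constructible_not constructible_zero constructible_ball) (simp_all add: polynomial_fun_var)
  then have "definable_int (\<lambda>s. of_bool (x \<in> leading to_nat (S s)))" for x
    by (intro definable_int_of_bool) (simp add: leading_def Bex_def Ball_def)
  then have "definable_int (\<lambda>s. \<Sum>x\<in>UNIV. of_bool (x \<in> leading to_nat (S s)))"
    by (rule definable_int_sum)
  moreover have "int (fdim (S s)) = (\<Sum>x\<in>UNIV. of_bool (x \<in> leading to_nat (S s)))" for s
    by (simp add: fdim_leading_finite[OF assms(2)] of_bool_def sum.If_cases)
  ultimately show ?thesis by simp
qed

section \<open>Families of subspaces over the vertices\<close>

definition supported :: "'a set \<Rightarrow> ('a \<Rightarrow> 'f::zero) set" where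
  "supported A = {a. \<forall>x. x \<notin> A \<longrightarrow> a x = 0}"

lemma fsubspace_supported: "fsubspace (supported A)"
  by (simp add: fsubspace_iff supported_def)

lemma fsubspace_Kval: "fsubspace (Kval k M A)"
  by (simp add: fsubspace_iff Kval_def distrib_right sum.distrib mult.assoc flip: sum_distrib_left)

lemma Kval_Suc: "Kval (Suc k) M A = {a\<in>Kval k M A. (\<Sum>x\<in>UNIV. a x * M k x) = 0}"
  by (auto simp: Kval_def less_Suc_eq)

lemma Kval_subset_supported: "Kval k M A \<subseteq> supported A"
  by (auto simp: Kval_def supported_def)

lemma Kval_cong: "(\<And>i x. i < k \<Longrightarrow> M i x = M' i x) \<Longrightarrow> Kval k M A = Kval k M' A"
  by (simp add: Kval_def)

lemma definable_family_Kval: "definable_family (\<lambda>s :: nat \<times> 'g::finite \<Rightarrow> 'f::field. Kval k (curry s) A)"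
proof -
  have "constructible (\<lambda>r :: (nat \<times> 'g) + 'g \<Rightarrow> 'f. (\<forall>x\<in>-A. r (Inr x) = 0) \<and>
      (\<forall>i\<in>{..<k}. (\<Sum>x\<in>UNIV. r (Inr x) * r (Inl (i, x))) = 0))"
    by (intro constructible_conj constructible_ball constructible_zero polynomial_fun_sum polynomial_fun_mult polynomial_fun_var) auto
  then show ?thesis by (simp add: definable_family_def Kval_def Ball_def)
qed

lemma mem_GL_vert: "x \<in> GL_vert VL v \<longleftrightarrow> v - x \<in> VL"
proof -
  have "v = g + x \<longleftrightarrow> g = v - x" for g by (metis diff_eq_eq)
  then show ?thesis by (auto simp: GL_vert_def)
qed

lemma mem_GL_edge: "x \<in> GL_edge EL (g, i) \<longleftrightarrow> (g - x, i) \<in> EL"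
proof -
  have "g = g' + x \<longleftrightarrow> g' = g - x" for g' by (metis diff_eq_eq)
  then show ?thesis by (force simp: GL_edge_def image_iff)
qed

section \<open>Right translation of vectors\<close>

definition shift :: "'g \<Rightarrow> ('g::group_add \<Rightarrow> 'f) \<Rightarrow> 'g \<Rightarrow> 'f" where
  "shift h a = (\<lambda>x. a (x - h))"

lemma shift_shift [simp]: "shift h (shift (- h) a) = a" "shift (- h) (shift h a) = a"
  by (simp_all add: shift_def)

lemma mem_shift_image: "a \<in> shift h ` S \<longleftrightarrow> shift (- h) a \<in> S"
proof
  assume "shift (- h) a \<in> S"
  then have "shift h (shift (- h) a) \<in> shift h ` S" by (rule imageI)
  then show "a \<in> shift h ` S" by simp
qed auto

lemma shift_image_Int: "shift h ` (S \<inter> T) = shift h ` S \<inter> shift h ` T"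
  by (intro set_eqI) (simp only: Int_iff mem_shift_image)

lemma fsubspace_shift: "fsubspace S \<Longrightarrow> fsubspace (shift h ` S)"
  by (simp add: fsubspace_iff mem_shift_image Ball_def) (simp add: shift_def)

text \<open>The dimension can be counted with any injective ranking. If \<open>S\<close> is counted
  with the translated ranking \<open>r\<close>, translation carries its leading positions
  bijectively to those of the image.\<close>

lemma fdim_shift:
  fixes S :: "('g::{group_add, finite} \<Rightarrow> 'f::field) set"
  assumes "fsubspace S"
  shows "fdim (shift h ` S) = fdim S"
proof -
  define r where "r x = (to_nat (x + h) :: nat)" for x :: 'g
  have "inj r" by (auto simp: inj_def r_def)
  then have "fdim S = card (leading r S)"
    using assms by (intro fdim_leading[of _ UNIV]) auto
  moreover have "leading to_nat (shift h ` S) = (\<lambda>x. x + h) ` leading r S"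
  proof (intro equalityI subsetI)
    fix x assume "x \<in> leading to_nat (shift h ` S)"
    then obtain a where a: "a \<in> S" "a (x - h) \<noteq> 0" "\<And>y. to_nat x < to_nat y \<Longrightarrow> a (y - h) = 0"
      by (auto simp: leading_def shift_def)
    have "a y = 0" if "r (x - h) < r y" for y
      using a(3)[of "y + h"] that by (simp add: r_def)
    then have "x - h \<in> leading r S" using a(1,2) by (auto simp: leading_def)
    then show "x \<in> (\<lambda>x. x + h) ` leading r S" by (metis diff_add_cancel imageI)
  next
    fix x assume "x \<in> (\<lambda>x. x + h) ` leading r S"
    then obtain z a where "x = z + h" "a \<in> S" "a z \<noteq> 0" "\<And>y. r z < r y \<Longrightarrow> a y = 0"
      by (auto simp: leading_def)
    then show "x \<in> leading to_nat (shift h ` S)"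
      by (auto simp: leading_def shift_def r_def intro!: exI[of _ a])
  qed
  ultimately show ?thesis
    using assms by (simp add: fdim_leading_finite fsubspace_shift card_image)
qed

lemma shift_Kval_vert:
  fixes M :: "nat \<Rightarrow> 'g::{group_add, finite} \<Rightarrow> 'f::field"
  assumes "a \<in> Kval k M (GL_vert VL v)"
  shows "shift h a \<in> Kval k (\<lambda>i. shift h (M i)) (GL_vert VL (v + h))"
proof -
  have "(\<Sum>x\<in>UNIV. a (x - h) * M i (x - h)) = (\<Sum>x\<in>UNIV. a x * M i x)" for i
    by (rule sum.reindex_bij_witness[of _ "\<lambda>x. x + h" "\<lambda>x. x - h"]) auto
  then show ?thesis
    using assms by (auto simp: Kval_def shift_def mem_GL_vert diff_diff_eq2)
qed

text \<open>Replacing a subspace of \<open>F(V)\<close> by the direct sum of its intersections with the stalks does not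
  decrease its excess, so it suffices to consider families \<open>U\<close> of subspaces of the stalks.\<close>

locale cayley_subgraph =
  fixes g1 g2 :: "'g::{group_add, finite}" and VL :: "'g set" and EL :: "('g \<times> nat) set"
  assumes subgraph: "is_subgraph g1 g2 VL EL"
begin

text \<open>In an admissible family the linear relations already hold at the vertices, so lying in
  the stalk of \<open>e\<close> reduces to a support condition. Thus \<open>excess\<close> does not
  mention the matrix, which enters only through \<open>admissible_family\<close>.\<close>

definition edge_space :: "('g \<Rightarrow> ('g \<Rightarrow> 'f::zero) set) \<Rightarrow> 'g \<times> nat \<Rightarrow> ('g \<Rightarrow> 'f) set" where
  "edge_space U e = U (head g1 g2 e) \<inter> U (tail e) \<inter> supported (GL_edge EL e)"

definition excess :: "('g \<Rightarrow> ('g \<Rightarrow> 'f::field) set) \<Rightarrow> int" where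
  "excess U = (\<Sum>e\<in>cayley_edges. int (fdim (edge_space U e))) - (\<Sum>v\<in>UNIV. int (fdim (U v)))"

definition admissible_family :: "nat \<Rightarrow> (nat \<Rightarrow> 'g \<Rightarrow> 'f::field) \<Rightarrow> ('g \<Rightarrow> ('g \<Rightarrow> 'f) set) \<Rightarrow> bool" where
  "admissible_family k M U \<longleftrightarrow> (\<forall>v. fsubspace (U v) \<and> U v \<subseteq> Kval k M (GL_vert VL v))"

definition is_maximizer :: "nat \<Rightarrow> (nat \<Rightarrow> 'g \<Rightarrow> 'f::field) \<Rightarrow> ('g \<Rightarrow> ('g \<Rightarrow> 'f) set) \<Rightarrow> bool" where
  "is_maximizer k M U \<longleftrightarrow> admissible_family k M U \<and> (\<forall>W. admissible_family k M W \<longrightarrow> excess W \<le> excess U)"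

definition least_maximizer :: "nat \<Rightarrow> (nat \<Rightarrow> 'g \<Rightarrow> 'f::field) \<Rightarrow> 'g \<Rightarrow> ('g \<Rightarrow> 'f) set" where
  "least_maximizer k M v = {a. \<forall>U. is_maximizer k M U \<longrightarrow> a \<in> U v}"

definition max_fexcess :: "nat \<Rightarrow> (nat \<Rightarrow> 'g \<Rightarrow> 'f::field) \<Rightarrow> int" where
  "max_fexcess k M = excess (least_maximizer k M)"

lemma finite_cayley_edges: "finite (cayley_edges :: ('g \<times> nat) set)"
  by (simp add: cayley_edges_def)

lemma fsubspace_edge_space: "(\<And>v. fsubspace (U v)) \<Longrightarrow> fsubspace (edge_space U e)"
  unfolding edge_space_def by (intro fsubspace_Int fsubspace_supported) auto

lemma excess_le: "excess (U :: 'g \<Rightarrow> ('g \<Rightarrow> 'f::field) set) \<le>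
    int (card (cayley_edges :: ('g \<times> nat) set)) * int (card (UNIV :: 'g set))"
proof -
  have "(\<Sum>e\<in>cayley_edges. int (fdim (edge_space U e))) \<le> (\<Sum>e\<in>(cayley_edges :: ('g \<times> nat) set). int (card (UNIV :: 'g set)))"
    by (intro sum_mono) (simp add: fdim_le_card)
  moreover have "0 \<le> (\<Sum>v\<in>UNIV. int (fdim (U v)))" by (intro sum_nonneg) auto
  ultimately show ?thesis by (simp add: excess_def)
qed

lemma excess_zero: "excess (\<lambda>v. {\<lambda>_. 0 :: 'f::field}) = 0"
proof -
  have "edge_space (\<lambda>v. {\<lambda>_. 0 :: 'f}) e = {\<lambda>_. 0}" for e
    by (auto simp: edge_space_def supported_def)
  then show ?thesis by (simp add: excess_def fdim_zero)
qed

lemma admissible_family_zero: "admissible_family k M (\<lambda>v. {\<lambda>_. 0})"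
  by (simp add: admissible_family_def fsubspace_iff Kval_def)

text \<open>The vertex terms are modular. On edges, intersections commute with
  \<open>edge_space\<close>, whereas the edge space of a sum contains, possibly strictly, the sum of
  the edge spaces.\<close>

lemma excess_supermodular:
  fixes U W :: "'g \<Rightarrow> ('g \<Rightarrow> 'f::field) set"
  assumes "\<And>v. fsubspace (U v)" "\<And>v. fsubspace (W v)"
  shows "excess U + excess W \<le> excess (\<lambda>v. subspace_sum (U v) (W v)) + excess (\<lambda>v. U v \<inter> W v)"
proof -
  have "int (fdim (edge_space U e)) + int (fdim (edge_space W e))
      \<le> int (fdim (edge_space (\<lambda>v. subspace_sum (U v) (W v)) e)) + int (fdim (edge_space (\<lambda>v. U v \<inter> W v) e))" for e
  proof -
    have "edge_space U e \<inter> edge_space W e = edge_space (\<lambda>v. U v \<inter> W v) e" unfolding edge_space_def by blast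
    moreover have "subspace_sum (edge_space U e) (edge_space W e) \<subseteq> edge_space (\<lambda>v. subspace_sum (U v) (W v)) e"
    proof (rule subspace_sum_subset)
      show "fsubspace (edge_space (\<lambda>v. subspace_sum (U v) (W v)) e)"
        by (intro fsubspace_edge_space fsubspace_subspace_sum assms)
      show "edge_space U e \<subseteq> edge_space (\<lambda>v. subspace_sum (U v) (W v)) e" "edge_space W e \<subseteq> edge_space (\<lambda>v. subspace_sum (U v) (W v)) e"
        using subset_subspace_sum[OF assms] unfolding edge_space_def by blast+
    qed
    then have "fdim (subspace_sum (edge_space U e) (edge_space W e)) \<le> fdim (edge_space (\<lambda>v. subspace_sum (U v) (W v)) e)"
      by (rule fdim_mono)
    ultimately show ?thesis
      using fdim_subspace_sum_Int[of "edge_space U e" "edge_space W e", OF fsubspace_edge_space[of U e, OF assms(1)]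
          fsubspace_edge_space[of W e, OF assms(2)]]
      by simp
  qed
  then have "(\<Sum>e\<in>cayley_edges. int (fdim (edge_space U e))) + (\<Sum>e\<in>cayley_edges. int (fdim (edge_space W e)))
     \<le> (\<Sum>e\<in>cayley_edges. int (fdim (edge_space (\<lambda>v. subspace_sum (U v) (W v)) e)))
       + (\<Sum>e\<in>cayley_edges. int (fdim (edge_space (\<lambda>v. U v \<inter> W v) e)))"
    unfolding sum.distrib[symmetric] by (intro sum_mono)
  moreover have "(\<Sum>v\<in>UNIV. int (fdim (subspace_sum (U v) (W v)))) + (\<Sum>v\<in>UNIV. int (fdim (U v \<inter> W v)))
     = (\<Sum>v\<in>UNIV. int (fdim (U v))) + (\<Sum>v\<in>UNIV. int (fdim (W v)))"
    unfolding sum.distrib[symmetric] of_nat_add[symmetric]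
    by (simp only: fdim_subspace_sum_Int[OF assms])
  ultimately show ?thesis by (simp add: excess_def)
qed

lemma is_maximizer_exists: "\<exists>U. is_maximizer k (M :: nat \<Rightarrow> 'g \<Rightarrow> 'f::field) U"
proof -
  \<comment> \<open>Any upper bound of the excess would do: it turns maximizing an integer into
    minimizing the natural number \<open>nat (B - excess U)\<close>.\<close>
  define B where "B = int (card (cayley_edges :: ('g \<times> nat) set)) * int (card (UNIV :: 'g set))"
  have B: "excess U \<le> B" for U :: "'g \<Rightarrow> ('g \<Rightarrow> 'f) set" unfolding B_def by (rule excess_le)
  obtain U where U: "admissible_family k M U"
    "\<forall>W. admissible_family k M W \<longrightarrow> nat (B - excess U) \<le> nat (B - excess W)"
    using ex_has_least_nat[of "admissible_family k M" "\<lambda>v. {\<lambda>_. 0}" "\<lambda>U. nat (B - excess U)", OF admissible_family_zero]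
    by (elim exE conjE)
  have "excess W \<le> excess U" if "admissible_family k M W" for W
  proof -
    have "nat (B - excess U) \<le> nat (B - excess W)" using U(2) that by blast
    then show ?thesis using B[of U] B[of W] by arith
  qed
  then show ?thesis using U(1) unfolding is_maximizer_def by blast
qed

lemma is_maximizer_Int:
  assumes "is_maximizer k M U" "is_maximizer k M W"
  shows "is_maximizer k M (\<lambda>v. U v \<inter> W v)"
proof -
  have U: "fsubspace (U v)" "U v \<subseteq> Kval k M (GL_vert VL v)"
    and W: "fsubspace (W v)" "W v \<subseteq> Kval k M (GL_vert VL v)" for v
    using assms by (auto simp: is_maximizer_def admissible_family_def)
  have "admissible_family k M (\<lambda>v. subspace_sum (U v) (W v))"
    unfolding admissible_family_def using U W by (intro allI conjI fsubspace_subspace_sum subspace_sum_subset fsubspace_Kval)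
  then have "excess (\<lambda>v. subspace_sum (U v) (W v)) \<le> excess U" using assms(1) by (simp add: is_maximizer_def)
  then have "excess W \<le> excess (\<lambda>v. U v \<inter> W v)"
    using excess_supermodular[of U W] U(1) W(1) by simp
  moreover have "admissible_family k M (\<lambda>v. U v \<inter> W v)"
    unfolding admissible_family_def using U W by (auto intro!: fsubspace_Int)
  ultimately show ?thesis
    using assms(2) unfolding is_maximizer_def by (meson order_trans)
qed

text \<open>By supermodularity the maximizers are closed under intersection.\<close>

lemma is_maximizer_least_maximizer: "is_maximizer k M (least_maximizer k M)"
proof -
  obtain U1 where U1: "is_maximizer k M U1" using is_maximizer_exists by blast
  \<comment> \<open>A maximizer of least total dimension loses nothing when intersected with another
    maximizer, so it lies in all of them.\<close>
  obtain U where U: "is_maximizer k M U"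
    "\<forall>W. is_maximizer k M W \<longrightarrow> (\<Sum>v\<in>UNIV. fdim (U v)) \<le> (\<Sum>v\<in>UNIV. fdim (W v))"
    using ex_has_least_nat[of "is_maximizer k M" U1 "\<lambda>W. \<Sum>v\<in>UNIV. fdim (W v)", OF U1]
    by (elim exE conjE)
  have "U v \<subseteq> W v" if W: "is_maximizer k M W" for W v
  proof -
    have le: "fdim (U w \<inter> W w) \<le> fdim (U w)" for w by (intro fdim_mono) auto
    have "fdim (U v) \<le> fdim (U v \<inter> W v)"
    proof (rule ccontr)
      assume "\<not> fdim (U v) \<le> fdim (U v \<inter> W v)"
      then have "(\<Sum>w\<in>UNIV. fdim (U w \<inter> W w)) < (\<Sum>w\<in>UNIV. fdim (U w))"
        using le by (intro sum_strict_mono_ex1) (auto simp: not_le)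
      then show False using U(2) is_maximizer_Int[OF U(1) W] by (meson not_le)
    qed
    then have "U v \<inter> W v = U v"
      using U(1) W by (intro fdim_eq_imp_eq) (auto simp: is_maximizer_def admissible_family_def intro: fsubspace_Int)
    then show ?thesis by blast
  qed
  then have "least_maximizer k M v = U v" for v using U(1) unfolding least_maximizer_def by blast
  then have "least_maximizer k M = U" by (rule ext)
  then show ?thesis using U(1) by simp
qed

lemma least_maximizer_subset: "is_maximizer k M U \<Longrightarrow> least_maximizer k M v \<subseteq> U v"
  by (auto simp: least_maximizer_def)

lemma fsubspace_least_maximizer: "fsubspace (least_maximizer k M v)"
  using is_maximizer_least_maximizer by (auto simp: is_maximizer_def admissible_family_def)

lemma excess_le_max_fexcess: "admissible_family k M U \<Longrightarrow> excess U \<le> max_fexcess k M"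
  using is_maximizer_least_maximizer[of k M] by (auto simp: is_maximizer_def max_fexcess_def)

lemma max_fexcess_nonneg: "0 \<le> max_fexcess k M"
  using excess_le_max_fexcess[OF admissible_family_zero, of k M] by (simp add: excess_zero)

lemma max_fexcess_eq_0:
  assumes "\<And>v. least_maximizer k M v \<subseteq> {\<lambda>_. 0}"
  shows "max_fexcess k M = 0"
proof -
  have "least_maximizer k M v = {\<lambda>_. 0}" for v
  proof -
    have "(\<lambda>_. 0) \<in> least_maximizer k M v" using fsubspace_least_maximizer[of k M v] by (simp only: fsubspace_iff)
    then show ?thesis using assms[of v] by blast
  qed
  then have "least_maximizer k M = (\<lambda>v. {\<lambda>_. 0})" by (rule ext)
  then show ?thesis by (simp add: max_fexcess_def excess_zero)
qed

lemma admissible_family_Suc: "admissible_family (Suc k) M U \<longleftrightarrow> admissible_family k M U \<and> (\<forall>v. \<forall>a\<in>U v. (\<Sum>x\<in>UNIV. a x * M k x) = 0)"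
  by (auto simp: admissible_family_def Kval_Suc)

lemma max_fexcess_Suc_le: "max_fexcess (Suc k) M \<le> max_fexcess k M"
  using excess_le_max_fexcess[of k M "least_maximizer (Suc k) M"] is_maximizer_least_maximizer[of "Suc k" M]
  by (simp add: is_maximizer_def admissible_family_Suc max_fexcess_def)

text \<open>If row \<open>k\<close> costs nothing, the least maximizer for \<open>Suc k\<close> rows
  is also a maximizer for \<open>k\<close> rows. It therefore contains the least one for
  \<open>k\<close> rows, which inherits its annihilation by row \<open>k\<close>.\<close>

lemma max_fexcess_Suc_eq:
  assumes "max_fexcess (Suc k) M = max_fexcess k M" "a \<in> least_maximizer k M v"
  shows "(\<Sum>x\<in>UNIV. a x * M k x) = 0"
proof -
  have "admissible_family (Suc k) M (least_maximizer (Suc k) M)" using is_maximizer_least_maximizer[of "Suc k" M] by (simp add: is_maximizer_def)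
  moreover from this have "is_maximizer k M (least_maximizer (Suc k) M)"
    using assms(1) excess_le_max_fexcess unfolding is_maximizer_def max_fexcess_def by (auto simp: admissible_family_Suc)
  then have "a \<in> least_maximizer (Suc k) M v" using least_maximizer_subset assms(2) by blast
  ultimately show ?thesis by (auto simp: admissible_family_Suc)
qed

lemma admissible_family_cong:
  assumes "\<And>i x. i < k \<Longrightarrow> M i x = M' i x"
  shows "admissible_family k M = admissible_family k M'"
  using Kval_cong[of k M M'] assms by (auto simp: admissible_family_def fun_eq_iff)

lemma max_fexcess_cong:
  assumes "\<And>i x. i < k \<Longrightarrow> M i x = M' i x"
  shows "max_fexcess k M = max_fexcess k M'"
proof -
  have "is_maximizer k M = is_maximizer k M'" using admissible_family_cong[OF assms] by (simp add: is_maximizer_def fun_eq_iff)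
  then show ?thesis by (simp add: max_fexcess_def least_maximizer_def[abs_def])
qed

section \<open>Right translation of families and of their maximizers\<close>

definition shiftU :: "'g \<Rightarrow> ('g \<Rightarrow> ('g \<Rightarrow> 'f) set) \<Rightarrow> 'g \<Rightarrow> ('g \<Rightarrow> 'f) set" where
  "shiftU h U v = shift h ` U (v - h)"

lemma admissible_family_shift: "admissible_family k M U \<Longrightarrow> admissible_family k (\<lambda>i. shift h (M i)) (shiftU h U)"
  unfolding admissible_family_def shiftU_def
proof (intro allI conjI)
  fix v
  assume U: "\<forall>v. fsubspace (U v) \<and> U v \<subseteq> Kval k M (GL_vert VL v)"
  then show "fsubspace (shift h ` U (v - h))" by (intro fsubspace_shift) blast
  show "shift h ` U (v - h) \<subseteq> Kval k (\<lambda>i. shift h (M i)) (GL_vert VL v)"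
    using U shift_Kval_vert[of _ k M VL "v - h" h] by auto
qed

lemma edge_space_shift:
  fixes U :: "'g \<Rightarrow> ('g \<Rightarrow> 'f::zero) set"
  shows "edge_space (shiftU h U) (g, i) = shift h ` edge_space U (g - h, i)"
proof -
  have "shift h ` supported (GL_edge EL (g - h, i)) = (supported (GL_edge EL (g, i)) :: ('g \<Rightarrow> 'f) set)"
  proof -
    have eq: "(\<forall>x. (g - h - x, i) \<notin> EL \<longrightarrow> a (x + h) = 0) \<longleftrightarrow> (\<forall>x. (g - x, i) \<notin> EL \<longrightarrow> a x = 0)"
      for a :: "'g \<Rightarrow> 'f"
    proof (intro iffI allI impI)
      fix x assume "\<forall>x. (g - h - x, i) \<notin> EL \<longrightarrow> a (x + h) = 0" "(g - x, i) \<notin> EL"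
      moreover have "g - h - (x - h) = g - x" by (simp add: diff_diff_eq2)
      ultimately show "a x = 0" by (metis diff_add_cancel)
    next
      fix x assume "\<forall>x. (g - x, i) \<notin> EL \<longrightarrow> a x = 0" "(g - h - x, i) \<notin> EL"
      moreover have "g - (x + h) = g - h - x" by (simp add: diff_conv_add_uminus minus_add add.assoc del: add_uminus_conv_diff)
      ultimately show "a (x + h) = 0" by metis
    qed
    show ?thesis
    proof (rule set_eqI)
      fix a :: "'g \<Rightarrow> 'f"
      have "a \<in> shift h ` supported (GL_edge EL (g - h, i)) \<longleftrightarrow>
          (\<forall>x. (g - h - x, i) \<notin> EL \<longrightarrow> a (x + h) = 0)"
        unfolding mem_shift_image by (simp add: supported_def mem_GL_edge shift_def)
      also have "\<dots> \<longleftrightarrow> a \<in> supported (GL_edge EL (g, i))"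
        unfolding eq by (simp add: supported_def mem_GL_edge)
      finally show "a \<in> shift h ` supported (GL_edge EL (g - h, i)) \<longleftrightarrow> a \<in> supported (GL_edge EL (g, i))" .
    qed
  qed
  moreover have "head g1 g2 (g - h, i) = head g1 g2 (g, i) - h" "tail (g - h, i) = tail (g, i) - h"
    by (simp_all add: head_def tail_def add_diff_eq)
  ultimately show ?thesis
    by (simp only: edge_space_def shiftU_def shift_image_Int)
qed

lemma excess_shift:
  assumes "\<And>v. fsubspace (U v)"
  shows "excess (shiftU h U) = excess U"
proof -
  have "(\<Sum>e\<in>cayley_edges. int (fdim (edge_space (shiftU h U) e))) = (\<Sum>e\<in>cayley_edges. int (fdim (edge_space U e)))"
  proof (rule sum.reindex_bij_witness[of _ "\<lambda>(g, i). (g + h, i)" "\<lambda>(g, i). (g - h, i)"])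
    fix e :: "'g \<times> nat" assume "e \<in> cayley_edges"
    show "int (fdim (edge_space U (case e of (g, i) \<Rightarrow> (g - h, i)))) = int (fdim (edge_space (shiftU h U) e))"
      using fdim_shift[OF fsubspace_edge_space[OF assms]] by (cases e) (simp add: edge_space_shift)
  qed (auto simp: cayley_edges_def)
  moreover have "(\<Sum>v\<in>UNIV. int (fdim (shiftU h U v))) = (\<Sum>v\<in>UNIV. int (fdim (U v)))"
    by (rule sum.reindex_bij_witness[of _ "\<lambda>v. v + h" "\<lambda>v. v - h"])
      (auto simp: shiftU_def fdim_shift[OF assms])
  ultimately show ?thesis by (simp add: excess_def)
qed

lemma is_maximizer_shift:
  assumes "is_maximizer k M U"
  shows "is_maximizer k (\<lambda>i. shift h (M i)) (shiftU h U)"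
  unfolding is_maximizer_def
proof (intro conjI allI impI)
  show "admissible_family k (\<lambda>i. shift h (M i)) (shiftU h U)" using assms admissible_family_shift[of k M U h] by (simp add: is_maximizer_def)
  fix W assume W: "admissible_family k (\<lambda>i. shift h (M i)) W"
  then have "admissible_family k M (shiftU (- h) W)" using admissible_family_shift[OF W, of "- h"] by simp
  then have "excess (shiftU (- h) W) \<le> excess U" using assms by (simp add: is_maximizer_def)
  moreover have "excess (shiftU (- h) W) = excess W" using W by (intro excess_shift) (simp add: admissible_family_def)
  moreover have "excess (shiftU h U) = excess U"
    using assms by (intro excess_shift) (simp add: is_maximizer_def admissible_family_def)
  ultimately show "excess W \<le> excess (shiftU h U)" by simp
qed

text \<open>The translate of the least maximizer is a maximizer for the translated matrix and so
  contains the least one there. Letting \<open>h\<close> vary over the group yields both directions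
  for generic dimensions.\<close>

lemma fdim_least_maximizer_shift: "fdim (least_maximizer k (\<lambda>i. shift h (M i)) v) \<le> fdim (least_maximizer k M (v - h))"
proof -
  have "least_maximizer k (\<lambda>i. shift h (M i)) v \<subseteq> shift h ` least_maximizer k M (v - h)"
    using least_maximizer_subset[OF is_maximizer_shift[OF is_maximizer_least_maximizer]] by (simp add: shiftU_def)
  from fdim_mono[OF this] show ?thesis by (simp only: fdim_shift[OF fsubspace_least_maximizer])
qed

lemma fdim_edge_space_least_maximizer_shift:
  "fdim (edge_space (least_maximizer k (\<lambda>i. shift h (M i))) (g, i)) \<le> fdim (edge_space (least_maximizer k M) (g - h, i))"
proof -
  have "least_maximizer k (\<lambda>i. shift h (M i)) v \<subseteq> shiftU h (least_maximizer k M) v" for v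
    by (rule least_maximizer_subset[OF is_maximizer_shift[OF is_maximizer_least_maximizer]])
  then have "edge_space (least_maximizer k (\<lambda>i. shift h (M i))) (g, i) \<subseteq> edge_space (shiftU h (least_maximizer k M)) (g, i)"
    unfolding edge_space_def by blast
  from fdim_mono[OF this] show ?thesis
    by (simp only: edge_space_shift fdim_shift[OF fsubspace_edge_space[OF fsubspace_least_maximizer]])
qed

end

context cayley_subgraph
begin

section \<open>The Euler characteristic of subgraphs\<close>

abbreviation conn :: "('g \<times> 'g) set" where
  "conn \<equiv> (adj g1 g2 EL \<union> (adj g1 g2 EL)\<inverse>)\<^sup>*"

definition inner :: "'g set \<Rightarrow> ('g \<times> nat) set" where
  "inner W = {e\<in>EL. head g1 g2 e \<in> W \<and> tail e \<in> W}"

lemma finite_EL: "finite EL"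
  using subgraph finite_cayley_edges finite_subset unfolding is_subgraph_def by blast

lemma equiv_conn: "equiv UNIV conn"
proof -
  have "sym conn" by (intro sym_rtrancl) (auto simp: sym_def)
  then show ?thesis by (simp add: equiv_def refl_rtrancl trans_rtrancl)
qed

lemma edge_conn: "e \<in> EL \<Longrightarrow> (tail e, head g1 g2 e) \<in> conn"
  unfolding adj_def by (rule r_into_rtrancl) blast

text \<open>The set \<open>W\<close> is grown to the whole component one vertex at a time, and every
  new vertex brings at least one new inner edge. Hence edges minus vertices never decreases along
  the way.\<close>

lemma component_edges:
  assumes "W \<subseteq> conn `` {x}" "W \<noteq> {}"
  shows "card (conn `` {x} - W) + card (inner W) \<le> card {e\<in>EL. tail e \<in> conn `` {x}}"
  using assms
proof (induction "card (conn `` {x} - W)" arbitrary: W)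
  case 0
  then have "W = conn `` {x}" by simp
  then show ?case using finite_EL by (auto intro!: card_mono simp: inner_def)
next
  case (Suc n)
  let ?X = "conn `` {x}"
  \<comment> \<open>Without an edge leaving \<open>W\<close>, every path from a point of
    \<open>W\<close> would stay in \<open>W\<close>, which would then be the whole
    component.\<close>
  have "\<exists>a\<in>W. \<exists>b\<in>?X - W. (a, b) \<in> adj g1 g2 EL \<union> (adj g1 g2 EL)\<inverse>"
  proof (rule ccontr)
    assume no: "\<not> ?thesis"
    obtain w where w: "w \<in> W" using Suc.prems(2) by blast
    have "y \<in> W" if "(w, y) \<in> conn" for y
      using that
    proof (induction rule: rtrancl_induct)
      case (step y z)
      have "z \<in> ?X"
        using w Suc.prems(1) step.hyps by (meson Image_singleton_iff rtrancl.rtrancl_into_rtrancl rtrancl_trans subsetD)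
      then show ?case using no step by blast
    qed (rule w)
    moreover have "(w, y) \<in> conn" if "y \<in> ?X" for y
      using that w Suc.prems(1) equiv_conn unfolding equiv_def sym_def trans_def by blast
    ultimately have "?X - W = {}" by blast
    then show False using Suc.hyps(2) by (metis card.empty nat.distinct(1))
  qed
  then obtain a b where ab: "a \<in> W" "b \<in> ?X - W" "(a, b) \<in> adj g1 g2 EL \<union> (adj g1 g2 EL)\<inverse>"
    by blast
  then obtain e where e: "e \<in> EL" "e \<in> inner (insert b W)" "e \<notin> inner W"
    by (auto simp: adj_def inner_def)
  have "card (insert e (inner W)) \<le> card (inner (insert b W))"
    using e finite_EL by (intro card_mono) (auto simp: inner_def)
  moreover have "card (insert e (inner W)) = Suc (card (inner W))"
    using e finite_EL by (simp add: inner_def)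
  moreover have "?X - insert b W = ?X - W - {b}" by blast
  then have n: "card (?X - insert b W) = n" using Suc.hyps(2) ab(2) by simp
  moreover have "card (?X - insert b W) + card (inner (insert b W)) \<le> card {e\<in>EL. tail e \<in> ?X}"
    using Suc.hyps(1)[of "insert b W"] n Suc.prems ab(2) by auto
  ultimately show ?case using Suc.hyps(2) by linarith
qed

lemma sum_components:
  assumes "V \<subseteq> VL"
  shows "card V = (\<Sum>X\<in>components g1 g2 VL EL. card (V \<inter> X))"
    and "card (inner V) = (\<Sum>X\<in>components g1 g2 VL EL. card (inner (V \<inter> X)))"
proof -
  let ?C = "components g1 g2 VL EL"
  have sub: "?C \<subseteq> UNIV // conn" by (auto simp: components_def quotient_def)
  have disj: "X \<inter> Y = {}" if "X \<in> ?C" "Y \<in> ?C" "X \<noteq> Y" for X Y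
    using quotient_disj[OF equiv_conn] that sub by blast
  have own: "v \<in> conn `` {v}" "conn `` {v} \<in> ?C" if "v \<in> V" for v
    using that assms by (auto simp: components_def quotient_def)
  have "V = (\<Union>X\<in>?C. V \<inter> X)" using own by blast
  then show "card V = (\<Sum>X\<in>?C. card (V \<inter> X))"
    using card_UN_disjoint[of ?C "\<lambda>X. V \<inter> X"] disj by (metis (no_types, lifting) finite disjoint_iff IntE)
  have closed: "head g1 g2 e \<in> X" if "e \<in> EL" "tail e \<in> X" "X \<in> ?C" for e X
    using that edge_conn[of e] by (auto simp: components_def quotient_def intro: rtrancl_trans)
  have "inner V = (\<Union>X\<in>?C. inner (V \<inter> X))"
  proof (intro equalityI subsetI)
    fix e assume "e \<in> inner V"
    then have e: "e \<in> EL" "head g1 g2 e \<in> V" "tail e \<in> V" by (auto simp: inner_def)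
    then show "e \<in> (\<Union>X\<in>?C. inner (V \<inter> X))"
      using own[OF e(3)] closed[OF e(1)] by (auto simp: inner_def)
  qed (auto simp: inner_def)
  moreover have "card (\<Union>X\<in>?C. inner (V \<inter> X)) = (\<Sum>X\<in>?C. card (inner (V \<inter> X)))"
  proof (rule card_UN_disjoint)
    show "\<forall>X\<in>?C. finite (inner (V \<inter> X))" using finite_EL by (simp add: inner_def)
    show "\<forall>X\<in>?C. \<forall>Y\<in>?C. X \<noteq> Y \<longrightarrow> inner (V \<inter> X) \<inter> inner (V \<inter> Y) = {}"
      using disj by (auto simp: inner_def)
  qed simp
  ultimately show "card (inner V) = (\<Sum>X\<in>?C. card (inner (V \<inter> X)))" by simp
qed

text \<open>Componentwise: a component missed by \<open>V\<close> contributes 0, and in a component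
  that \<open>V\<close> meets, \<open>component_edges\<close> bounds the contribution by edges minus
  vertices of the component. This is where the maximum with 0 in \<open>rho\<close> comes
  from.\<close>

lemma inner_le_rho:
  assumes "V \<subseteq> VL"
  shows "int (card (inner V)) - int (card V) \<le> int (rho g1 g2 VL EL)"
proof -
  let ?C = "components g1 g2 VL EL"
  have "int (card (inner (V \<inter> X))) - int (card (V \<inter> X))
      \<le> int (nat (max 0 (int (card {e\<in>EL. tail e \<in> X}) - int (card X))))" if "X \<in> ?C" for X
  proof (cases "V \<inter> X = {}")
    case True
    then show ?thesis by (simp add: inner_def)
  next
    case False
    obtain x where x: "X = conn `` {x}" using \<open>X \<in> ?C\<close> by (auto simp: components_def quotient_def)
    have "card (X - V \<inter> X) + card (inner (V \<inter> X)) \<le> card {e\<in>EL. tail e \<in> X}"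
      using component_edges[of "V \<inter> X" x] False unfolding x by blast
    moreover have "card (X - V \<inter> X) + card (V \<inter> X) = card X"
      by (simp add: card_Diff_subset card_mono)
    ultimately show ?thesis by linarith
  qed
  then have "(\<Sum>X\<in>?C. int (card (inner (V \<inter> X))) - int (card (V \<inter> X)))
    \<le> (\<Sum>X\<in>?C. int (nat (max 0 (int (card {e\<in>EL. tail e \<in> X}) - int (card X)))))"
    by (rule sum_mono)
  then show ?thesis
    by (simp add: rho_def sum_components[OF assms] sum_subtractf of_nat_sum del: of_nat_nat int_nat_eq)
qed

text \<open>An edge is determined by its tail and its generator, so at most \<open>card X\<close>
  edges of a component \<open>X\<close> use the other generator; any surplus of edges over vertices
  is covered by those using \<open>i\<close>. This provides enough columns at every edge for
  L-surjectivity.\<close>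

lemma rho_le_edges:
  assumes "i \<in> {1, 2}"
  shows "rho g1 g2 VL EL \<le> card {w. (w, i) \<in> EL}"
proof -
  let ?C = "components g1 g2 VL EL"
  have sub: "?C \<subseteq> UNIV // conn" by (auto simp: components_def quotient_def)
  have disj: "X \<inter> Y = {}" if "X \<in> ?C" "Y \<in> ?C" "X \<noteq> Y" for X Y
    using quotient_disj[OF equiv_conn] that sub by blast
  have EL: "snd e \<in> {1, 2}" if "e \<in> EL" for e
    using that subgraph by (auto simp: is_subgraph_def cayley_edges_def)
  have "nat (max 0 (int (card {e\<in>EL. tail e \<in> X}) - int (card X))) \<le> card {w\<in>X. (w, i) \<in> EL}" for X
  proof -
    \<comment> \<open>As \<open>i\<close> is 1 or 2, \<open>3 - i\<close> is the other
      generator.\<close>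
    have "{e\<in>EL. tail e \<in> X} \<subseteq> {w\<in>X. (w, i) \<in> EL} \<times> {i} \<union> X \<times> {3 - i}"
      using EL assms by (force simp: tail_def)
    then have "card {e\<in>EL. tail e \<in> X} \<le> card ({w\<in>X. (w, i) \<in> EL} \<times> {i} \<union> X \<times> {3 - i})"
      by (intro card_mono) auto
    also have "\<dots> \<le> card {w\<in>X. (w, i) \<in> EL} + card X"
      by (rule order_trans[OF card_Un_le]) (simp add: card_cartesian_product)
    finally show ?thesis by simp
  qed
  then have "rho g1 g2 VL EL \<le> (\<Sum>X\<in>?C. card {w\<in>X. (w, i) \<in> EL})"
    unfolding rho_def by (rule sum_mono)
  also have "\<dots> = card (\<Union>X\<in>?C. {w\<in>X. (w, i) \<in> EL})"
    using disj by (intro card_UN_disjoint[symmetric]) auto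
  also have "\<dots> \<le> card {w. (w, i) \<in> EL}" by (intro card_mono) auto
  finally show ?thesis .
qed

text \<open>For each \<open>x\<close>, the vertices at which \<open>x\<close> is a leading position form a vertex set of the
  translate \<open>Lx\<close>, and the edges at which \<open>x\<close> is leading are inside this vertex set.\<close>

lemma excess_le_rho:
  fixes U :: "'g \<Rightarrow> ('g \<Rightarrow> 'f::field) set"
  assumes "\<And>v. fsubspace (U v)" "\<And>v. U v \<subseteq> supported (GL_vert VL v)"
  shows "excess U \<le> int (rho g1 g2 VL EL) * int (card (UNIV :: 'g set))"
proof -
  define D where "D v = leading to_nat (U v)" for v
  \<comment> \<open>Translated back by \<open>x\<close>, so that the vertex set lies in
    \<open>VL\<close> itself and not in a translate.\<close>
  define V where "V x = {w. x \<in> D (w + x)}" for x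
  have cnt: "(\<Sum>x\<in>UNIV. of_bool (x \<in> S)) = int (card S)" for S :: "'g set"
    by (simp add: of_bool_def sum.If_cases)
  have U: "int (fdim (U v)) = (\<Sum>x\<in>UNIV. of_bool (x \<in> D v))" for v
    unfolding cnt D_def by (simp only: fdim_leading_finite[OF assms(1)])
  have edge_space: "int (fdim (edge_space U e)) \<le> (\<Sum>x\<in>UNIV. of_bool (x \<in> D (head g1 g2 e) \<inter> D (tail e) \<inter> GL_edge EL e))" for e
  proof -
    have "leading to_nat (edge_space U e) \<subseteq> D (head g1 g2 e) \<inter> D (tail e) \<inter> GL_edge EL e"
      unfolding D_def edge_space_def leading_def supported_def by blast
    then have "card (leading to_nat (edge_space U e)) \<le> card (D (head g1 g2 e) \<inter> D (tail e) \<inter> GL_edge EL e)"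
      by (intro card_mono) auto
    then show ?thesis
      unfolding cnt fdim_leading_finite[OF fsubspace_edge_space[of U e, OF assms(1)]] by simp
  qed
  have E: "(\<Sum>e\<in>cayley_edges. of_bool (x \<in> D (head g1 g2 e) \<inter> D (tail e) \<inter> GL_edge EL e)) = int (card (inner (V x)))" for x
  proof -
    have "bij_betw (\<lambda>(g, i). (g + x, i)) (inner (V x))
      {e\<in>cayley_edges. x \<in> D (head g1 g2 e) \<inter> D (tail e) \<inter> GL_edge EL e}"
    proof (rule bij_betw_byWitness[where f' = "\<lambda>(g, i). (g - x, i)"])
      have EL: "EL \<subseteq> cayley_edges" using subgraph by (simp add: is_subgraph_def)
      show "(\<lambda>(g, i). (g + x, i)) ` inner (V x) \<subseteq>
        {e\<in>cayley_edges. x \<in> D (head g1 g2 e) \<inter> D (tail e) \<inter> GL_edge EL e}"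
        using EL by (auto simp: inner_def V_def head_def tail_def mem_GL_edge add.assoc cayley_edges_def)
      show "(\<lambda>(g, i). (g - x, i)) ` {e\<in>cayley_edges. x \<in> D (head g1 g2 e) \<inter> D (tail e) \<inter> GL_edge EL e}
        \<subseteq> inner (V x)"
        by (auto simp: inner_def V_def head_def tail_def mem_GL_edge add.assoc)
    qed auto
    then have "card (inner (V x)) = card {e\<in>cayley_edges. x \<in> D (head g1 g2 e) \<inter> D (tail e) \<inter> GL_edge EL e}"
      by (rule bij_betw_same_card)
    moreover have "{e\<in>cayley_edges. x \<in> D (head g1 g2 e) \<inter> D (tail e) \<inter> GL_edge EL e}
      = cayley_edges \<inter> {e. x \<in> D (head g1 g2 e) \<inter> D (tail e) \<inter> GL_edge EL e}" by blast
    ultimately show ?thesis by (simp only: sum_of_bool_eq[OF finite_cayley_edges finite_cayley_edges])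
  qed
  have W: "(\<Sum>v\<in>UNIV. of_bool (x \<in> D v)) = int (card (V x))" for x
  proof -
    have "bij_betw (\<lambda>w. w + x) (V x) {v. x \<in> D v}"
      by (rule bij_betw_byWitness[where f' = "\<lambda>g. g - x"]) (auto simp: V_def)
    then have "card (V x) = card {v. x \<in> D v}" by (rule bij_betw_same_card)
    then show ?thesis using cnt[of "{v. x \<in> D v}"] by simp
  qed
  have VVL: "V x \<subseteq> VL" for x
  proof
    fix w assume "w \<in> V x"
    then obtain a where "a \<in> U (w + x)" "a x \<noteq> 0" by (auto simp: V_def D_def leading_def)
    then have "x \<in> GL_vert VL (w + x)" using assms(2) by (auto simp: supported_def)
    then show "w \<in> VL" by (simp add: mem_GL_vert)
  qed
  have "excess U \<le> (\<Sum>e\<in>cayley_edges. \<Sum>x\<in>UNIV. of_bool (x \<in> D (head g1 g2 e) \<inter> D (tail e) \<inter> GL_edge EL e))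
      - (\<Sum>v\<in>UNIV. \<Sum>x\<in>UNIV. of_bool (x \<in> D v))"
    unfolding excess_def U by (intro diff_right_mono sum_mono edge_space)
  also have "(\<Sum>e\<in>cayley_edges. \<Sum>x\<in>UNIV. of_bool (x \<in> D (head g1 g2 e) \<inter> D (tail e) \<inter> GL_edge EL e))
      = (\<Sum>x\<in>UNIV. int (card (inner (V x))))"
    unfolding E[symmetric] by (rule sum.swap)
  also have "(\<Sum>v\<in>UNIV. \<Sum>x\<in>UNIV. of_bool (x \<in> D v)) = (\<Sum>x\<in>UNIV. int (card (V x)))"
    unfolding W[symmetric] by (rule sum.swap)
  also have "(\<Sum>x\<in>UNIV. int (card (inner (V x)))) - (\<Sum>x\<in>UNIV. int (card (V x)))
      = (\<Sum>x\<in>UNIV. int (card (inner (V x))) - int (card (V x)))"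
    by (simp add: sum_subtractf)
  also have "\<dots> \<le> (\<Sum>x\<in>(UNIV :: 'g set). int (rho g1 g2 VL EL))"
    by (intro sum_mono inner_le_rho VVL)
  finally show ?thesis by (simp add: mult.commute)
qed

lemma max_fexcess_le_rho: "max_fexcess k M \<le> int (rho g1 g2 VL EL) * int (card (UNIV :: 'g set))"
proof -
  have "admissible_family k M (least_maximizer k M)" using is_maximizer_least_maximizer[of k M] by (simp add: is_maximizer_def)
  then show ?thesis
    unfolding max_fexcess_def admissible_family_def using Kval_subset_supported by (intro excess_le_rho) blast+
qed

end

context cayley_subgraph
begin

section \<open>The generic value of the maximum excess\<close>

definition family_of :: "('g \<times> 'g \<times> 'g \<Rightarrow> 'f::field) \<Rightarrow> 'g \<Rightarrow> ('g \<Rightarrow> 'f) set" where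
  "family_of b v = combinations (\<lambda>(j, x). b (v, j, x))"

lemma fsubspace_family_of: "fsubspace (family_of b v)"
  by (simp add: family_of_def fsubspace_combinations)

lemma eq_family_of:
  fixes U :: "'g \<Rightarrow> ('g \<Rightarrow> 'f::field) set"
  assumes "\<And>v. fsubspace (U v)"
  shows "\<exists>b. U = family_of b"
proof -
  have "\<forall>v. \<exists>b :: 'g \<times> 'g \<Rightarrow> 'f. U v = combinations b"
    by (intro allI fsubspace_eq_combinations assms)
  then obtain b :: "'g \<Rightarrow> 'g \<times> 'g \<Rightarrow> 'f" where b: "\<forall>v. U v = combinations (b v)"
    by (rule choice[THEN exE])
  show ?thesis
    by (rule exI[of _ "\<lambda>(v, j, x). b v (j, x)"]) (simp add: fun_eq_iff family_of_def b)
qed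

lemma definable_family_family_of: "definable_family (\<lambda>b :: 'g \<times> 'g \<times> 'g \<Rightarrow> 'f::alg_closed_field. family_of b v)"
  unfolding family_of_def
  by (rule definable_family_subst[OF definable_family_combinations]) (auto intro: polynomial_fun_var)

lemma definable_int_excess:
  fixes S :: "('v \<Rightarrow> 'f::alg_closed_field) \<Rightarrow> 'g \<Rightarrow> ('g \<Rightarrow> 'f) set"
  assumes "\<And>v. definable_family (\<lambda>s. S s v)" "\<And>s v. fsubspace (S s v)"
  shows "definable_int (\<lambda>s. excess (S s))" "definable_int (\<lambda>s. int (fdim (edge_space (S s) e)))"
proof -
  have "definable_family (\<lambda>s. edge_space (S s) e)" for e
    unfolding edge_space_def supported_def by (intro definable_family_Int definable_family_supp assms(1))
  then have G: "definable_int (\<lambda>s. int (fdim (edge_space (S s) e)))" for e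
    by (rule definable_int_fdim) (rule fsubspace_edge_space[OF assms(2)])
  then show "definable_int (\<lambda>s. int (fdim (edge_space (S s) e)))" .
  show "definable_int (\<lambda>s. excess (S s))"
    unfolding excess_def
    by (rule definable_int2) (intro definable_int_sum G definable_int_fdim[OF assms(1)] assms(2))+
qed

lemma constructible_admissible_family:
  fixes s :: "('v \<Rightarrow> 'f::alg_closed_field) \<Rightarrow> nat \<times> 'g \<Rightarrow> 'f"
  assumes "\<And>v. (\<lambda>r. s r v) \<in> polynomial_fun" "\<And>v. (\<lambda>r. b r v) \<in> polynomial_fun"
  shows "constructible (\<lambda>r. admissible_family k (curry (s r)) (family_of (b r)))"
proof -
  have "constructible (\<lambda>r. \<forall>v\<in>UNIV. family_of (b r) v \<subseteq> Kval k (curry (s r)) (GL_vert VL v))"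
    by (intro constructible_ball constructible_subset definable_family_subst[OF definable_family_family_of assms(2)] definable_family_subst[OF definable_family_Kval assms(1)]) simp
  then show ?thesis by (simp add: admissible_family_def fsubspace_family_of)
qed

text \<open>Every competitor has a code, so the quantifier over families may range over codes, that
  is, over finitely many field elements, as \<open>constructible_all\<close> requires.\<close>

lemma is_maximizer_family_of_iff:
  "is_maximizer k M (family_of b) \<longleftrightarrow> admissible_family k M (family_of b) \<and> (\<forall>b'. admissible_family k M (family_of b') \<longrightarrow> excess (family_of b') \<le> excess (family_of b))"
  (is "?L \<longleftrightarrow> ?R")
proof
  assume R: ?R
  have "excess W \<le> excess (family_of b)" if "admissible_family k M W" for W
  proof -
    have "\<exists>b'. W = family_of b'" using that by (intro eq_family_of) (simp add: admissible_family_def)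
    then obtain b' where "W = family_of b'" ..
    then show ?thesis using R that by blast
  qed
  then show ?L using R by (simp add: is_maximizer_def)
qed (simp add: is_maximizer_def)

lemma constructible_is_maximizer:
  fixes s :: "('v \<Rightarrow> 'f::alg_closed_field) \<Rightarrow> nat \<times> 'g \<Rightarrow> 'f"
  assumes "\<And>v. (\<lambda>r. s r v) \<in> polynomial_fun" "\<And>v. (\<lambda>r. b r v) \<in> polynomial_fun"
  shows "constructible (\<lambda>r. is_maximizer k (curry (s r)) (family_of (b r)))"
  unfolding is_maximizer_family_of_iff
proof (intro constructible_conj constructible_admissible_family assms constructible_all constructible_imp)
  have Inl: "(\<lambda>r :: 'v + 'g \<times> 'g \<times> 'g \<Rightarrow> 'f. (r \<circ> Inl) v) \<in> polynomial_fun" for v by (simp add: polynomial_fun_var)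
  show "(\<lambda>r :: 'v + 'g \<times> 'g \<times> 'g \<Rightarrow> 'f. s (r \<circ> Inl) v) \<in> polynomial_fun" for v
    by (rule polynomial_fun_subst[OF assms(1) Inl])
  show "(\<lambda>r :: 'v + 'g \<times> 'g \<times> 'g \<Rightarrow> 'f. (r \<circ> Inr) v) \<in> polynomial_fun" for v by (simp add: polynomial_fun_var)
  have d: "definable_int (\<lambda>b :: 'g \<times> 'g \<times> 'g \<Rightarrow> 'f. excess (family_of b))"
    by (intro definable_int_excess definable_family_family_of fsubspace_family_of)
  have "definable_int (\<lambda>r :: 'v + 'g \<times> 'g \<times> 'g \<Rightarrow> 'f. excess (family_of (r \<circ> Inr)))"
    by (rule definable_int_subst[OF d]) (simp add: polynomial_fun_var)
  moreover have "definable_int (\<lambda>r :: 'v + 'g \<times> 'g \<times> 'g \<Rightarrow> 'f. excess (family_of (b (r \<circ> Inl))))"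
    by (rule definable_int_subst[OF d polynomial_fun_subst[OF assms(2) Inl]])
  ultimately show "constructible (\<lambda>r :: 'v + 'g \<times> 'g \<times> 'g \<Rightarrow> 'f. excess (family_of (r \<circ> Inr)) \<le> excess (family_of (b (r \<circ> Inl))))"
    by (rule constructible_definable_int2)
qed

text \<open>Being defined as the intersection of all maximizers, the least maximizer is described by
  one universal quantifier over codes, without any choice.\<close>

lemma definable_family_least_maximizer: "definable_family (\<lambda>s :: nat \<times> 'g \<Rightarrow> 'f::alg_closed_field. least_maximizer k (curry s) v)"
proof -
  have "constructible (\<lambda>r :: (nat \<times> 'g) + 'g \<Rightarrow> 'f. \<forall>b. is_maximizer k (curry (r \<circ> Inl)) (family_of b) \<longrightarrow> (r \<circ> Inr) \<in> family_of b v)"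
    by (intro constructible_all constructible_imp constructible_is_maximizer constructible_mem[OF definable_family_family_of]) (simp_all add: polynomial_fun_var)
  moreover have "(\<forall>b. is_maximizer k M (family_of b) \<longrightarrow> a \<in> family_of b v) \<longleftrightarrow> a \<in> least_maximizer k M v"
    for M and a :: "'g \<Rightarrow> 'f"
  proof -
    have "\<exists>b. U = family_of b" if "is_maximizer k M U" for U
      using that by (intro eq_family_of) (simp add: is_maximizer_def admissible_family_def)
    then show ?thesis unfolding least_maximizer_def by blast
  qed
  ultimately show ?thesis by (simp add: definable_family_def)
qed

lemma definable_int_max_fexcess: "definable_int (\<lambda>s :: nat \<times> 'g \<Rightarrow> 'f::alg_closed_field. max_fexcess k (curry s))"
  unfolding max_fexcess_def by (intro definable_int_excess definable_family_least_maximizer fsubspace_least_maximizer)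

end

text \<open>If row \<open>k\<close> generically annihilates \<open>S\<close>, then so does its translate by a unit vector; hence
  every coordinate of every vector in \<open>S\<close> vanishes.\<close>

lemma generically_row:
  fixes S :: "(nat \<times> 'g::finite \<Rightarrow> 'f::alg_closed_field) \<Rightarrow> ('g \<Rightarrow> 'f) set"
  assumes S: "definable_family S" and indep: "\<And>s x c. S (s((k, x) := c)) = S s"
  shows "generically (\<lambda>s. (\<forall>a\<in>S s. (\<Sum>x\<in>UNIV. a x * s (k, x)) = 0) \<longrightarrow> S s \<subseteq> {\<lambda>_. 0})"
proof -
  let ?P = "\<lambda>s. \<forall>a\<in>S s. (\<Sum>x\<in>UNIV. a x * s (k, x)) = 0"
  have "constructible (\<lambda>s. \<forall>a. a \<in> S s \<longrightarrow> (\<Sum>x\<in>UNIV. a x * s (k, x)) = 0)"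
    by (intro constructible_all constructible_imp constructible_mem[OF S] constructible_zero polynomial_fun_sum polynomial_fun_mult) (simp_all add: polynomial_fun_var)
  then have "constructible ?P" by (simp add: Ball_def)
  then consider "generically ?P" | "generically (\<lambda>s. \<not> ?P s)"
    using generically_cases by blast
  then show ?thesis
  proof cases
    case 1
    \<comment> \<open>Adding 1 to one entry of row \<open>k\<close> is a surjective polynomial map,
      so it preserves genericity; by \<open>indep\<close> it leaves \<open>S s\<close>
      unchanged.\<close>
    have "generically (\<lambda>s. ?P (s((k, x) := s (k, x) + 1)))" for x
    proof (rule generically_subst[OF 1])
      fix v
      show "(\<lambda>s :: nat \<times> 'g \<Rightarrow> 'f. (s((k, x) := s (k, x) + 1)) v) \<in> polynomial_fun"
        by (cases "v = (k, x)") (auto intro: polynomial_fun_var polynomial_fun_add polynomial_fun_const)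
      show "surj (\<lambda>s :: nat \<times> 'g \<Rightarrow> 'f. s((k, x) := s (k, x) + 1))"
        by (rule surjI[of _ "\<lambda>s. s((k, x) := s (k, x) - 1)"]) auto
    qed
    then have "generically (\<lambda>s. \<forall>x\<in>UNIV. ?P (s((k, x) := s (k, x) + 1)))"
      by (intro generically_ball) auto
    from generically_conj[OF 1 this] show ?thesis
    proof (rule generically_mono, intro impI subsetI)
      fix s a
      assume s: "?P s \<and> (\<forall>x\<in>UNIV. ?P (s((k, x) := s (k, x) + 1)))" and a: "a \<in> S s"
      have "a y = 0" for y
      proof -
        let ?s = "s((k, y) := s (k, y) + 1)"
        have "(\<Sum>x\<in>UNIV. a x * ?s (k, x)) = (\<Sum>x\<in>UNIV. a x * s (k, x) + (if x = y then a x else 0))"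
          by (intro sum.cong) (auto simp: algebra_simps)
        also have "\<dots> = (\<Sum>x\<in>UNIV. a x * s (k, x)) + a y" by (simp add: sum.distrib)
        finally show ?thesis using s a indep by auto
      qed
      then show "a \<in> {\<lambda>_. 0}" by auto
    qed
  next
    \<comment> \<open>Here the premise of the claimed implication generically fails.\<close>
    case 2
    then show ?thesis by (rule generically_mono) blast
  qed
qed

context cayley_subgraph
begin

text \<open>Translation by \<open>h\<close> permutes the columns of a generic matrix, so generically the dimension of the
  least maximizer is the same at all vertices and at all edges with the same generator.\<close>

lemma generic_max_fexcess_dvd:
  assumes "generically (\<lambda>s :: nat \<times> 'g \<Rightarrow> 'f::alg_closed_field. max_fexcess k (curry s) = m)"
  shows "int (card (UNIV :: 'g set)) dvd m"
proof -
  have "\<forall>v. \<exists>d. generically (\<lambda>s :: nat \<times> 'g \<Rightarrow> 'f. int (fdim (least_maximizer k (curry s) v)) = d)"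
    by (intro allI definable_int_generic_value definable_int_fdim definable_family_least_maximizer fsubspace_least_maximizer)
  then obtain d where "\<forall>v. generically (\<lambda>s :: nat \<times> 'g \<Rightarrow> 'f. int (fdim (least_maximizer k (curry s) v)) = d v)"
    by (rule choice[THEN exE])
  then have d: "generically (\<lambda>s :: nat \<times> 'g \<Rightarrow> 'f. int (fdim (least_maximizer k (curry s) v)) = d v)" for v ..
  have "\<forall>e. \<exists>c. generically (\<lambda>s :: nat \<times> 'g \<Rightarrow> 'f. int (fdim (edge_space (least_maximizer k (curry s)) e)) = c)"
    by (intro allI definable_int_generic_value definable_int_excess(2) definable_family_least_maximizer fsubspace_least_maximizer)
  then obtain c where "\<forall>e. generically (\<lambda>s :: nat \<times> 'g \<Rightarrow> 'f. int (fdim (edge_space (least_maximizer k (curry s)) e)) = c e)"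
    by (rule choice[THEN exE])
  then have c: "generically (\<lambda>s :: nat \<times> 'g \<Rightarrow> 'f. int (fdim (edge_space (least_maximizer k (curry s)) e)) = c e)" for e ..
  define translate :: "'g \<Rightarrow> (nat \<times> 'g \<Rightarrow> 'f) \<Rightarrow> nat \<times> 'g \<Rightarrow> 'f" where "translate h s = (\<lambda>(i, x). s (i, x - h))" for h s
  have curry_translate: "curry (translate h s) = (\<lambda>i. shift h (curry s i))" for h s
    by (simp add: translate_def shift_def fun_eq_iff)
  have sh_poly: "(\<lambda>s. translate h s v) \<in> polynomial_fun" for h v by (cases v) (simp add: translate_def polynomial_fun_var)
  have sh_surj: "surj (translate h)" for h
    by (rule surjI[of _ "translate (- h)"]) (auto simp: translate_def)
  have le: "d w \<le> d (w - h)" for w h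
  proof -
    obtain s where "int (fdim (least_maximizer k (curry (translate h s)) w)) = d w" "int (fdim (least_maximizer k (curry s) (w - h))) = d (w - h)"
      using generically_ex[OF generically_conj[OF generically_subst[OF d[of w] sh_poly sh_surj, of h] d[of "w - h"]]]
      by blast
    then show ?thesis using fdim_least_maximizer_shift[of k h "curry s" w] by (simp add: curry_translate)
  qed
  \<comment> \<open>Translation by \<open>w\<close> gives \<open>d w \<le> d 0\<close>, and
    translation of 0 by \<open>- w\<close> gives the converse.\<close>
  then have d0: "d w = d 0" for w using le[of w w] le[of 0 "- w"] by simp
  have le': "c (w, i) \<le> c (w - h, i)" for w i h
  proof -
    obtain s where "int (fdim (edge_space (least_maximizer k (curry (translate h s))) (w, i))) = c (w, i)"
        "int (fdim (edge_space (least_maximizer k (curry s)) (w - h, i))) = c (w - h, i)"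
      using generically_ex[OF generically_conj[OF generically_subst[OF c[of "(w, i)"] sh_poly sh_surj, of h] c[of "(w - h, i)"]]]
      by blast
    then show ?thesis using fdim_edge_space_least_maximizer_shift[of k h "curry s" w i] by (simp add: curry_translate)
  qed
  then have c0: "c (w, i) = c (0, i)" for w i using le'[of w i w] le'[of 0 i "- w"] by simp
  \<comment> \<open>Finitely many generic values are attained at one common matrix, so the generic
    excess can be computed from \<open>c\<close> and \<open>d\<close>.\<close>
  have gen: "generically (\<lambda>s :: nat \<times> 'g \<Rightarrow> 'f. max_fexcess k (curry s) = m \<and>
      (\<forall>v\<in>UNIV. int (fdim (least_maximizer k (curry s) v)) = d v) \<and>
      (\<forall>e\<in>cayley_edges. int (fdim (edge_space (least_maximizer k (curry s)) e)) = c e))"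
    by (intro generically_conj assms generically_ball d c finite_cayley_edges) simp
  obtain s :: "nat \<times> 'g \<Rightarrow> 'f" where s: "max_fexcess k (curry s) = m"
    "\<And>v. int (fdim (least_maximizer k (curry s) v)) = d v"
    "\<And>e. e \<in> cayley_edges \<Longrightarrow> int (fdim (edge_space (least_maximizer k (curry s)) e)) = c e"
    using generically_ex[OF gen] by auto
  have "m = (\<Sum>e\<in>cayley_edges. c e) - (\<Sum>v\<in>UNIV. d v)"
    using s(1) unfolding max_fexcess_def excess_def by (simp add: s(2,3))
  also have "\<dots> = int (card (UNIV :: 'g set)) * (c (0, 1) + c (0, 2) - d 0)"
  proof -
    have "(\<Sum>e\<in>cayley_edges. c e) = (\<Sum>g\<in>UNIV. \<Sum>i\<in>{1, 2}. c (g, i))"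
      by (simp only: cayley_edges_def sum.cartesian_product case_prod_eta)
    also have "\<dots> = (\<Sum>g\<in>(UNIV :: 'g set). c (0, 1) + c (0, 2))"
    proof (rule sum.cong)
      show "(\<Sum>i\<in>{1, 2}. c (g, i)) = c (0, 1) + c (0, 2)" for g
        using c0[of g 1] c0[of g 2] by simp
    qed simp
    finally have "(\<Sum>e\<in>cayley_edges. c e) = (\<Sum>g\<in>(UNIV :: 'g set). c (0, 1) + c (0, 2))" .
    moreover have "(\<Sum>v\<in>UNIV. d v) = (\<Sum>v\<in>(UNIV :: 'g set). d 0)" by (intro sum.cong refl d0)
    ultimately show ?thesis by (simp add: algebra_simps)
  qed
  finally show ?thesis by simp
qed

text \<open>If an additional row does not decrease the maximum excess, then the least maximizer for \<open>k\<close> rows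
  is annihilated by row \<open>k\<close>, so it is generically zero. Otherwise the drop is at least the group order.\<close>

lemma generic_max_fexcess_le:
  "generically (\<lambda>s :: nat \<times> 'g \<Rightarrow> 'f::alg_closed_field.
     max_fexcess k (curry s) \<le> max 0 ((int (rho g1 g2 VL EL) - int k) * int (card (UNIV :: 'g set))))"
proof (induction k)
  case 0
  show ?case by (intro generically_all) (use max_fexcess_le_rho in \<open>auto simp: max_def\<close>)
next
  case (Suc k)
  define N where "N = int (card (UNIV :: 'g set))"
  have "0 < N" by (simp add: N_def card_gt_0_iff)
  obtain m where m: "generically (\<lambda>s :: nat \<times> 'g \<Rightarrow> 'f. max_fexcess k (curry s) = m)"
    using definable_int_generic_value[OF definable_int_max_fexcess] by blast
  obtain m' where m': "generically (\<lambda>s :: nat \<times> 'g \<Rightarrow> 'f. max_fexcess (Suc k) (curry s) = m')"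
    using definable_int_generic_value[OF definable_int_max_fexcess] by blast
  \<comment> \<open>The least maximizer for \<open>k\<close> rows depends only on the rows before
    row \<open>k\<close>, so row \<open>k\<close> is still free to vary against it.\<close>
  have row: "generically (\<lambda>s :: nat \<times> 'g \<Rightarrow> 'f. \<forall>v\<in>UNIV.
     (\<forall>a\<in>least_maximizer k (curry s) v. (\<Sum>x\<in>UNIV. a x * s (k, x)) = 0) \<longrightarrow> least_maximizer k (curry s) v \<subseteq> {\<lambda>_. 0})"
  proof (intro generically_ball generically_row definable_family_least_maximizer)
    fix v x c and s :: "nat \<times> 'g \<Rightarrow> 'f"
    have "admissible_family k (curry (s((k, x) := c))) = admissible_family k (curry s)" by (rule admissible_family_cong) simp
    then show "least_maximizer k (curry (s((k, x) := c))) v = least_maximizer k (curry s) v" by (simp add: least_maximizer_def is_maximizer_def)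
  qed simp
  obtain s :: "nat \<times> 'g \<Rightarrow> 'f" where s: "max_fexcess k (curry s) = m" "max_fexcess (Suc k) (curry s) = m'"
      "max_fexcess k (curry s) \<le> max 0 ((int (rho g1 g2 VL EL) - int k) * N)"
      "\<forall>v\<in>UNIV. (\<forall>a\<in>least_maximizer k (curry s) v. (\<Sum>x\<in>UNIV. a x * s (k, x)) = 0) \<longrightarrow> least_maximizer k (curry s) v \<subseteq> {\<lambda>_. 0}"
    using generically_ex[OF generically_conj[OF m generically_conj[OF m' generically_conj[OF Suc.IH row]]]]
    unfolding N_def by blast
  have "m' \<le> m" using max_fexcess_Suc_le[of k "curry s"] s by simp
  have "m = 0" if "m' = m"
  proof -
    have "least_maximizer k (curry s) v \<subseteq> {\<lambda>_. 0}" for v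
      using s(4) max_fexcess_Suc_eq[of k "curry s" _ v] s(1,2) that by (simp add: curry_def)
    from max_fexcess_eq_0[OF this] show ?thesis using s(1) by simp
  qed
  moreover have "N dvd m" "N dvd m'" using generic_max_fexcess_dvd[OF m] generic_max_fexcess_dvd[OF m'] by (auto simp: N_def)
  then obtain a b where ab: "m = N * a" "m' = N * b" by (elim dvdE)
  moreover have "0 \<le> m'" using max_fexcess_nonneg[of "Suc k" "curry s"] s by simp
  \<comment> \<open>Either the value is unchanged, and then both are 0, or it drops strictly between
    two multiples of \<open>N\<close> and thus by at least \<open>N\<close>.\<close>
  ultimately have "m' \<le> max 0 (m - N)"
  proof (cases "m' = m")
    case False
    then have "m' < m" using \<open>m' \<le> m\<close> by simp
    then have "N * b < N * a" unfolding ab .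
    then have "b + 1 \<le> a" using \<open>0 < N\<close> by simp
    then have "N * (b + 1) \<le> N * a" using \<open>0 < N\<close> by (intro mult_left_mono) auto
    then show ?thesis using ab by (simp add: distrib_left)
  qed auto
  also have "\<dots> \<le> max 0 ((int (rho g1 g2 VL EL) - int (Suc k)) * N)"
    using s(1,3) \<open>0 < N\<close> by (auto simp: algebra_simps max_def split: if_splits)
  finally have "m' \<le> max 0 ((int (rho g1 g2 VL EL) - int (Suc k)) * N)" .
  with m' show ?case
    unfolding N_def by (elim generically_mono) (simp only:)
qed

end

section \<open>Surjectivity\<close>

text \<open>If a generic row does not shrink the kernel, it annihilates all of it, so the kernel is
  already zero by \<open>generically_row\<close>. Otherwise the dimension drops by at least one;
  truncated subtraction covers both cases.\<close>

lemma generic_fdim_Kval: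
  "generically (\<lambda>s :: nat \<times> 'g::finite \<Rightarrow> 'f::alg_closed_field. fdim (Kval k (curry s) A) \<le> card A - k)"
proof (induction k)
  case 0
  have "fdim (Kval 0 M A) \<le> card A" for M :: "nat \<Rightarrow> 'g \<Rightarrow> 'f"
    unfolding fdim_leading_finite[OF fsubspace_Kval]
    by (rule card_mono) (auto simp: leading_def Kval_def)
  then show ?case by (intro generically_all) simp
next
  case (Suc k)
  have "generically (\<lambda>s :: nat \<times> 'g \<Rightarrow> 'f. (\<forall>a\<in>Kval k (curry s) A. (\<Sum>x\<in>UNIV. a x * s (k, x)) = 0) \<longrightarrow>
      Kval k (curry s) A \<subseteq> {\<lambda>_. 0})"
  proof (rule generically_row[OF definable_family_Kval])
    show "Kval k (curry (s((k, x) := c))) A = Kval k (curry s) A" for s :: "nat \<times> 'g \<Rightarrow> 'f" and x c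
      by (rule Kval_cong) simp
  qed
  from generically_conj[OF Suc.IH this] show ?case
  proof (rule generically_mono)
    fix s :: "nat \<times> 'g \<Rightarrow> 'f"
    let ?S = "Kval k (curry s) A" and ?T = "Kval (Suc k) (curry s) A"
    assume *: "fdim ?S \<le> card A - k \<and> ((\<forall>a\<in>?S. (\<Sum>x\<in>UNIV. a x * s (k, x)) = 0) \<longrightarrow> ?S \<subseteq> {\<lambda>_. 0})"
    have sub: "?T \<subseteq> ?S" by (auto simp: Kval_Suc)
    show "fdim ?T \<le> card A - Suc k"
    proof (cases "?S \<subseteq> ?T")
      case True
      then have "\<forall>a\<in>?S. (\<Sum>x\<in>UNIV. a x * s (k, x)) = 0" by (auto simp: Kval_Suc)
      then have "?T \<subseteq> {\<lambda>_. 0}" using * sub by blast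
      then have "leading to_nat ?T = {}" by (auto simp: leading_def)
      then show ?thesis by (simp add: fdim_leading_finite[OF fsubspace_Kval])
    next
      case False
      then have "\<not> fdim ?S \<le> fdim ?T"
        using fdim_eq_imp_eq[OF fsubspace_Kval fsubspace_Kval sub] by blast
      then show ?thesis using * by linarith
    qed
  qed
qed

lemma fsubspace_Fk: "fsubspace (Fk k)"
  by (auto simp: fsubspace_iff Fk_def)

lemma Fk_subset_span: "Fk k \<subseteq> fs.span ((\<lambda>i j. if j = i then 1 else 0 :: 'f::field) ` {..<k})"
proof
  fix v :: "nat \<Rightarrow> 'f" assume v: "v \<in> Fk k"
  have "v = (\<Sum>i<k. fscale (v i) (\<lambda>j. if j = i then 1 else 0))"
  proof
    fix j
    have "(\<Sum>i<k. fscale (v i) (\<lambda>j. if j = i then 1 else 0)) j = (\<Sum>i<k. if i = j then v i else 0)"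
      unfolding sum_fun_apply by (intro sum.cong) (auto simp: fscale_def)
    then show "v j = (\<Sum>i<k. fscale (v i) (\<lambda>j. if j = i then 1 else 0)) j"
      using v by (auto simp: Fk_def)
  qed
  also have "\<dots> \<in> fs.span ((\<lambda>i j. if j = i then 1 else 0) ` {..<k})"
    by (intro fs.span_sum fs.span_scale fs.span_base) auto
  finally show "v \<in> fs.span ((\<lambda>i j. if j = i then 1 else 0) ` {..<k})" .
qed

text \<open>Rank-nullity in echelon form. A relation among the columns in \<open>A0\<close> would be
  a kernel vector whose leading position lies in \<open>A0\<close>, yet \<open>A0\<close> avoids all
  leading positions of the kernel. So at least \<open>k\<close> columns are independent in the
  \<open>k\<close>-dimensional space \<open>Fk k\<close>.\<close>

lemma fspan_cols:
  fixes M :: "nat \<Rightarrow> 'g::finite \<Rightarrow> 'f::field"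
  assumes M: "M \<in> mats k" and "k \<le> card A" "fdim (Kval k M A) \<le> card A - k"
  shows "fspan (col M ` A) = Fk k"
proof -
  define A0 where "A0 = A - leading to_nat (Kval k M A)"
  have "leading to_nat (Kval k M A) \<subseteq> A" by (auto simp: leading_def Kval_def)
  then have "card A0 = card A - fdim (Kval k M A)"
    by (simp add: A0_def fdim_leading_finite[OF fsubspace_Kval] card_Diff_subset)
  then have card: "k \<le> card A0" using assms(2,3) by linarith
  have rel: "c x = 0" if c: "\<And>i. (\<Sum>x\<in>A0. c x * M i x) = 0" and x: "x \<in> A0" for c x
  proof (rule ccontr)
    assume "c x \<noteq> 0"
    define a where "a x = (if x \<in> A0 then c x else 0)" for x
    have "(\<Sum>x\<in>UNIV. a x * M i x) = (\<Sum>x\<in>A0. c x * M i x)" for i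
      by (rule sum.mono_neutral_cong_right) (auto simp: a_def)
    then have aK: "a \<in> Kval k M A" using c by (auto simp: Kval_def a_def A0_def)
    have ex: "\<exists>y. y \<in> {y. a y \<noteq> 0}" using \<open>c x \<noteq> 0\<close> x by (auto simp: a_def)
    obtain y where y: "a y \<noteq> 0" "\<And>z. a z \<noteq> 0 \<Longrightarrow> (to_nat z :: nat) \<le> to_nat y"
    proof -
      have "Max (to_nat ` {y. a y \<noteq> 0}) \<in> (to_nat ` {y. a y \<noteq> 0} :: nat set)"
        using ex by (intro Max_in) auto
      then obtain y where "a y \<noteq> 0" "Max (to_nat ` {y. a y \<noteq> 0}) = (to_nat y :: nat)" by auto
      moreover have "to_nat z \<le> Max (to_nat ` {y. a y \<noteq> 0} :: nat set)" if "a z \<noteq> 0" for z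
        using that by (intro Max_ge) auto
      ultimately show thesis using that by metis
    qed
    then have "y \<in> leading to_nat (Kval k M A)"
      unfolding leading_def using aK by (auto intro!: bexI[of _ a] simp: not_le[symmetric])
    moreover have "y \<in> A0" using y(1) by (auto simp: a_def split: if_splits)
    ultimately show False by (simp add: A0_def)
  qed
  have inj: "inj_on (col M) A0"
  proof (rule inj_onI, rule ccontr)
    fix x y assume xy: "x \<in> A0" "y \<in> A0" "col M x = col M y" "x \<noteq> y"
    define c where "c z = (if z = x then 1 else if z = y then - 1 else 0 :: 'f)" for z
    have "(\<Sum>z\<in>A0. c z * M i z) = 0" for i
    proof -
      have "(\<Sum>z\<in>A0. c z * M i z) = (\<Sum>z\<in>A0. (if z = x then M i z else 0) - (if z = y then M i z else 0))"
        using xy(4) by (intro sum.cong) (auto simp: c_def)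
      also have "\<dots> = M i x - M i y" using xy(1,2) by (simp add: sum_subtractf)
      finally show ?thesis using fun_cong[OF xy(3), of i] by (simp add: col_def)
    qed
    from rel[OF this xy(1)] show False by (simp add: c_def)
  qed
  have indep: "fs.independent (col M ` A0)"
  proof (rule fs.independent_if_scalars_zero)
    fix f v assume 0: "(\<Sum>v\<in>col M ` A0. fscale (f v) v) = 0" and v: "v \<in> col M ` A0"
    have "(\<Sum>x\<in>A0. f (col M x) * M i x) = 0" for i
    proof -
      have "(\<Sum>v\<in>col M ` A0. fscale (f v) v) i = (\<Sum>x\<in>A0. f (col M x) * M i x)"
        using inj by (simp add: sum_fun_apply sum.reindex fscale_def) (simp add: col_def)
      then show ?thesis using 0 by simp
    qed
    from rel[of "\<lambda>x. f (col M x)", OF this] show "f v = 0" using v by blast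
  qed simp
  have cols: "col M ` A \<subseteq> Fk k" using M by (auto simp: mats_def Fk_def col_def)
  have "Fk k \<subseteq> fs.span (col M ` A0)"
  proof (rule ccontr)
    assume "\<not> ?thesis"
    then obtain v where v: "v \<in> Fk k" "v \<notin> fs.span (col M ` A0)" by blast
    let ?u = "\<lambda>i j. if j = i then 1 else 0 :: 'f"
    have "fs.independent (insert v (col M ` A0))" using fs.independent_insertI[OF v(2) indep] .
    moreover have "insert v (col M ` A0) \<subseteq> fs.span (?u ` {..<k})"
      using v(1) cols Fk_subset_span[of k] by (auto simp: A0_def)
    ultimately have "card (insert v (col M ` A0)) \<le> card (?u ` {..<k})"
      using fs.independent_span_bound[of "?u ` {..<k}"] by auto
    moreover have "card (?u ` {..<k}) \<le> k" using card_image_le[of "{..<k}" ?u] by simp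
    moreover have "v \<notin> col M ` A0" using v(2) fs.span_base by blast
    then have "card (insert v (col M ` A0)) = Suc (card A0)"
      using inj by (simp add: card_image)
    ultimately show False using card by simp
  qed
  also have "\<dots> \<subseteq> fs.span (col M ` A)" by (intro fs.span_mono) (auto simp: A0_def)
  finally have "Fk k \<subseteq> fs.span (col M ` A)" .
  moreover have "fs.span (col M ` A) \<subseteq> Fk k"
    using cols fsubspace_Fk unfolding fsubspace_def by (rule fs.span_minimal)
  ultimately show ?thesis unfolding fspan_def by blast
qed

section \<open>Comparison with the maximum excess of the sheaf\<close>

text \<open>Lexicographic ranking, first by fibre and then within the fibre; the factor exceeds
  every rank within a fibre.\<close>

definition lexrank :: "'i::countable \<times> 'a::finite \<Rightarrow> nat" where
  "lexrank p = to_nat (fst p) * Suc (Max (range (to_nat :: 'a \<Rightarrow> nat))) + to_nat (snd p)"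

lemma lexrank_less:
  fixes i j :: "'i::countable" and x y :: "'b::finite"
  shows "lexrank (i, x) < lexrank (j, y) \<longleftrightarrow> to_nat i < to_nat j \<or> i = j \<and> to_nat x < to_nat y"
proof -
  let ?C = "Suc (Max (range (to_nat :: 'b \<Rightarrow> nat)))"
  have C: "to_nat z < ?C" for z :: 'b by (simp add: less_Suc_eq_le)
  have *: "m * ?C + to_nat u < n * ?C + to_nat w" if "m < n" for m n and u w :: 'b
  proof -
    have "m * ?C + to_nat u < Suc m * ?C" using C[of u] by simp
    also have "\<dots> \<le> n * ?C" using that by (intro mult_le_mono1) simp
    finally show ?thesis by simp
  qed
  have "to_nat i < to_nat j \<or> to_nat j < to_nat i \<or> i = j"
    by (metis from_nat_to_nat linorder_neqE_nat)
  then show ?thesis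
    using *[of "to_nat i" "to_nat j" x y] *[of "to_nat j" "to_nat i" y x]
    by (auto simp: lexrank_def)
qed

lemma inj_lexrank: "inj_on lexrank A"
proof (rule inj_onI)
  fix p q :: "'i::countable \<times> 'b::finite" assume "lexrank p = lexrank q"
  moreover obtain i x j y where "p = (i, x)" "q = (j, y)" by (cases p, cases q)
  ultimately have "\<not> lexrank (i, x) < lexrank (j, y)" "\<not> lexrank (j, y) < lexrank (i, x)" by simp_all
  then have "to_nat i = to_nat j" "i = j \<longrightarrow> to_nat x = to_nat y" unfolding lexrank_less by auto
  then show "p = q" using \<open>p = (i, x)\<close> \<open>q = (j, y)\<close> by simp
qed

text \<open>Under \<open>lexrank\<close>, the leading position of a vector lies in its last nonzero
  fibre and is leading there. So restriction to fibres embeds the leading positions of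
  \<open>S\<close> into those of the \<open>T i\<close>, and extension by zero gives the reverse.
  The index type is merely countable, with a finite \<open>I\<close>, because edges are pairs over
  the infinite type \<open>nat\<close>.\<close>

lemma fdim_fibres:
  fixes S :: "('i::countable \<times> 'a::finite \<Rightarrow> 'f::field) set"
  assumes I: "finite I" and S: "fsubspace S" "\<And>w i x. w \<in> S \<Longrightarrow> i \<notin> I \<Longrightarrow> w (i, x) = 0"
    and T: "\<And>i. i \<in> I \<Longrightarrow> fsubspace (T i)"
  shows "(\<And>w i. w \<in> S \<Longrightarrow> i \<in> I \<Longrightarrow> (\<lambda>x. w (i, x)) \<in> T i) \<Longrightarrow> fdim S \<le> (\<Sum>i\<in>I. fdim (T i))"
    and "(\<And>a i. i \<in> I \<Longrightarrow> a \<in> T i \<Longrightarrow> (\<lambda>(j, x). if j = i then a x else 0) \<in> S) \<Longrightarrow>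
      (\<Sum>i\<in>I. fdim (T i)) \<le> fdim S"
proof -
  have supp: "S \<subseteq> {w. \<forall>p. p \<notin> I \<times> UNIV \<longrightarrow> w p = 0}" using S(2) by auto
  have fS: "fdim S = card (leading lexrank S)"
    using I by (intro fdim_leading[OF S(1) _ inj_lexrank supp]) simp
  have sub: "leading lexrank S \<subseteq> I \<times> UNIV" using supp by (auto simp: leading_def)
  have card: "(\<Sum>i\<in>I. fdim (T i)) = card (SIGMA i:I. leading to_nat (T i))"
    using I T by (simp add: fdim_leading_finite)
  {
    assume W: "\<And>w i. w \<in> S \<Longrightarrow> i \<in> I \<Longrightarrow> (\<lambda>x. w (i, x)) \<in> T i"
    have "leading lexrank S \<subseteq> (SIGMA i:I. leading to_nat (T i))"
    proof
      fix p assume p: "p \<in> leading lexrank S"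
      obtain i x where ix: "p = (i, x)" by (cases p)
      obtain w where w: "w \<in> S" "w (i, x) \<noteq> 0" "\<And>q. lexrank (i, x) < lexrank q \<Longrightarrow> w q = 0"
        using p ix unfolding leading_def by blast
      have "i \<in> I" using p sub ix by auto
      moreover have "x \<in> leading to_nat (T i)"
        unfolding leading_def using w W[OF w(1) \<open>i \<in> I\<close>] by (auto intro!: bexI[of _ "\<lambda>x. w (i, x)"] simp: lexrank_less)
      ultimately show "p \<in> (SIGMA i:I. leading to_nat (T i))" by (simp add: ix)
    qed
    then show "fdim S \<le> (\<Sum>i\<in>I. fdim (T i))"
      unfolding fS card using I by (intro card_mono) auto
  next
    assume W: "\<And>a i. i \<in> I \<Longrightarrow> a \<in> T i \<Longrightarrow> (\<lambda>(j, x). if j = i then a x else 0) \<in> S"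
    have "(SIGMA i:I. leading to_nat (T i)) \<subseteq> leading lexrank S"
    proof
      fix p assume "p \<in> (SIGMA i:I. leading to_nat (T i))"
      then obtain i x a where p: "p = (i, x)" "i \<in> I" "a \<in> T i" "a x \<noteq> 0" "\<And>y. to_nat x < to_nat y \<Longrightarrow> a y = 0"
        by (auto simp: leading_def)
      have "(\<lambda>(j, x). if j = i then a x else 0) q = 0" if "lexrank (i, x) < lexrank q" for q
        using that p(5) by (cases q) (auto simp: lexrank_less)
      then show "p \<in> leading lexrank S"
        unfolding leading_def p(1) using p(4) W[OF p(2,3)]
        by (intro CollectI bexI[of _ "\<lambda>(j, x). if j = i then a x else 0"]) simp_all
    qed
    then show "(\<Sum>i\<in>I. fdim (T i)) \<le> fdim S"
      unfolding fS card using sub I by (intro card_mono) (auto intro: finite_subset)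
  }
qed

context cayley_subgraph
begin

lemma card_GL_vert: "card (GL_vert VL v) = card VL"
proof -
  have "bij_betw (\<lambda>x. v - x) (GL_vert VL v) VL"
    by (rule bij_betw_byWitness[where f' = "\<lambda>w. - w + v"]) (auto simp: mem_GL_vert diff_conv_add_uminus minus_add add.assoc simp del: add_uminus_conv_diff)
  then show ?thesis by (rule bij_betw_same_card)
qed

lemma card_GL_edge: "card (GL_edge EL (g, i)) = card {w. (w, i) \<in> EL}"
proof -
  have "bij_betw (\<lambda>x. g - x) (GL_edge EL (g, i)) {w. (w, i) \<in> EL}"
    by (rule bij_betw_byWitness[where f' = "\<lambda>w. - w + g"]) (auto simp: mem_GL_edge diff_conv_add_uminus minus_add add.assoc simp del: add_uminus_conv_diff)
  then show ?thesis by (rule bij_betw_same_card)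
qed

lemma rho_le_vertices: "rho g1 g2 VL EL \<le> card VL"
proof -
  have "{w. (w, 1) \<in> EL} \<subseteq> VL" using subgraph by (force simp: is_subgraph_def tail_def)
  then have "card {w. (w, 1 :: nat) \<in> EL} \<le> card VL" by (intro card_mono) auto
  then show ?thesis using rho_le_edges[of 1] by simp
qed

text \<open>Assignments carry entries for all rows; those from row \<open>k\<close> on are cut off
  to land in \<open>mats k\<close>.\<close>

definition matrix_of :: "nat \<Rightarrow> (nat \<times> 'g \<Rightarrow> 'f::zero) \<Rightarrow> nat \<Rightarrow> 'g \<Rightarrow> 'f" where
  "matrix_of k s = (\<lambda>i x. if i < k then s (i, x) else 0)"

lemma matrix_of_mats: "matrix_of k s \<in> mats k"
  by (simp add: matrix_of_def mats_def)

lemma generic_L_surjective: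
  "generically (\<lambda>s :: nat \<times> 'g \<Rightarrow> 'f::alg_closed_field.
     L_surjective g1 g2 VL EL (rho g1 g2 VL EL) (matrix_of (rho g1 g2 VL EL) s))"
proof -
  let ?k = "rho g1 g2 VL EL"
  have "generically (\<lambda>s :: nat \<times> 'g \<Rightarrow> 'f. \<forall>A\<in>UNIV. fdim (Kval ?k (curry s) A) \<le> card A - ?k)"
    by (intro generically_ball generic_fdim_Kval) simp
  then show ?thesis
  proof (rule generically_mono)
    fix s :: "nat \<times> 'g \<Rightarrow> 'f"
    assume s: "\<forall>A\<in>UNIV. fdim (Kval ?k (curry s) A) \<le> card A - ?k"
    have span: "fspan (col (matrix_of ?k s) ` A) = Fk ?k" if "?k \<le> card A" for A
    proof (rule fspan_cols[OF matrix_of_mats that])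
      have "Kval ?k (matrix_of ?k s) A = Kval ?k (curry s) A" by (rule Kval_cong) (simp add: matrix_of_def)
      then show "fdim (Kval ?k (matrix_of ?k s) A) \<le> card A - ?k" using s by simp
    qed
    show "L_surjective g1 g2 VL EL ?k (matrix_of ?k s)"
      unfolding L_surjective_def
    proof (intro conjI allI ballI span)
      show "?k \<le> card (GL_vert VL v)" for v by (simp add: card_GL_vert rho_le_vertices)
      show "?k \<le> card (GL_edge EL e)" if "e \<in> cayley_edges" for e
        using that rho_le_edges by (cases e) (simp add: card_GL_edge cayley_edges_def)
    qed
  qed
qed

text \<open>The stalkwise parts \<open>W v\<close> together have dimension at most that of
  \<open>U\<close>, whereas \<open>Gamma_ht\<close> tests membership in \<open>U\<close> only for
  vectors inserted at a single vertex, so it sees no more of \<open>U\<close> than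
  \<open>W\<close>.\<close>

lemma sheaf_excess_le:
  fixes M :: "nat \<Rightarrow> 'g \<Rightarrow> 'f::field"
  assumes U: "fsubspace U" "U \<subseteq> FV VL k M"
  shows "int (fdim (Gamma_ht g1 g2 EL k M U)) - int (fdim U) \<le> max_fexcess k M"
proof -
  define W where "W v = {a. dins v a \<in> U}" for v
  have W: "admissible_family k M W"
    unfolding admissible_family_def
  proof (intro allI conjI subsetI)
    fix v
    have "dins v (\<lambda>x. 0 :: 'f) = (\<lambda>_. 0)" "dins v (\<lambda>x. c * a x) = (\<lambda>p. c * dins v a p)"
      "dins v (\<lambda>x. a x + b x) = (\<lambda>p. dins v a p + dins v b p)" for a b :: "'g \<Rightarrow> 'f" and c
      by (auto simp: dins_def fun_eq_iff)
    then show "fsubspace (W v)" using U(1) by (simp add: fsubspace_iff W_def)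
    fix a assume "a \<in> W v"
    then have "(\<lambda>x. dins v a (v, x)) \<in> KV VL k M v" using U(2) by (auto simp: W_def FV_def)
    then show "a \<in> Kval k M (GL_vert VL v)" by (simp add: dins_def KV_def)
  qed
  then have Ws: "fsubspace (W v)" for v by (simp add: admissible_family_def)
  have "(\<Sum>v\<in>UNIV. fdim (W v)) \<le> fdim U"
  proof (rule fdim_fibres(2)[OF _ U(1) _ Ws])
    show "(\<lambda>(j, x). if j = v then a x else 0) \<in> U" if "a \<in> W v" for a v
      using that by (simp add: W_def dins_def)
  qed auto
  moreover have "fdim (Gamma_ht g1 g2 EL k M U) \<le> (\<Sum>e\<in>cayley_edges. fdim (edge_space W e))"
  proof (rule fdim_fibres(1)[OF finite_cayley_edges])
    have d: "dins v (\<lambda>x. 0 :: 'f) = (\<lambda>_. 0)" "dins v (\<lambda>x. c * a x) = (\<lambda>p. c * dins v a p)"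
      "dins v (\<lambda>x. a x + b x) = (\<lambda>p. dins v a p + dins v b p)" for v and a b :: "'g \<Rightarrow> 'f" and c
      by (auto simp: dins_def fun_eq_iff)
    show "fsubspace (Gamma_ht g1 g2 EL k M U)"
      using U(1) fsubspace_Kval[of k M] unfolding fsubspace_iff Gamma_ht_def
      by (simp add: KE_def d_h_def d_t_def d)
    show "fsubspace (edge_space W e)" for e by (rule fsubspace_edge_space[OF Ws])
    show "w (e, x) = 0" if "w \<in> Gamma_ht g1 g2 EL k M U" "e \<notin> cayley_edges" for w e x
      using that unfolding Gamma_ht_def by blast
    show "(\<lambda>x. w (e, x)) \<in> edge_space W e" if "w \<in> Gamma_ht g1 g2 EL k M U" "e \<in> cayley_edges" for w e
      using that Kval_subset_supported[of k M "GL_edge EL e"]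
      by (auto simp: Gamma_ht_def edge_space_def W_def d_h_def d_t_def KE_def)
  qed
  ultimately have "int (fdim (Gamma_ht g1 g2 EL k M U)) - int (fdim U) \<le> excess W"
    unfolding excess_def of_nat_sum[symmetric] by linarith
  also have "\<dots> \<le> max_fexcess k M" by (rule excess_le_max_fexcess[OF W])
  finally show ?thesis .
qed

text \<open>\<open>Max\<close> is meaningful only on a finite set; the values are integers confined
  to an interval, whose lower end comes from the dimension of the ambient space. The zero subspace
  yields the bound from below by 0.\<close>

lemma max_excess_bounds:
  fixes M :: "nat \<Rightarrow> 'g \<Rightarrow> 'f::field"
  shows "0 \<le> max_excess g1 g2 VL EL k M" "max_excess g1 g2 VL EL k M \<le> max_fexcess k M"
proof -
  let ?E = "{int (fdim (Gamma_ht g1 g2 EL k M U)) - int (fdim U) | U. fsubspace U \<and> U \<subseteq> FV VL k M}"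
  have "?E \<subseteq> {- int (card (UNIV :: ('g \<times> 'g) set)) .. max_fexcess k M}"
  proof
    fix n assume "n \<in> ?E"
    then obtain U where "n = int (fdim (Gamma_ht g1 g2 EL k M U)) - int (fdim U)" "fsubspace U" "U \<subseteq> FV VL k M"
      by blast
    then show "n \<in> {- int (card (UNIV :: ('g \<times> 'g) set)) .. max_fexcess k M}"
      using sheaf_excess_le[of U k M] fdim_le_card[of U] by simp
  qed
  then have fin: "finite ?E" by (rule finite_subset) simp
  have "{\<lambda>_. 0} \<subseteq> FV VL k M" by (simp add: FV_def KV_def Kval_def)
  moreover have "fsubspace {\<lambda>_ :: 'g \<times> 'g. 0 :: 'f}" by (simp add: fsubspace_iff)
  ultimately have mem: "int (fdim (Gamma_ht g1 g2 EL k M {\<lambda>_. 0})) - int (fdim {\<lambda>_ :: 'g \<times> 'g. 0 :: 'f}) \<in> ?E"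
    by blast
  have "0 \<le> int (fdim (Gamma_ht g1 g2 EL k M {\<lambda>_. 0})) - int (fdim {\<lambda>_ :: 'g \<times> 'g. 0 :: 'f})"
    by (simp add: fdim_zero)
  also have "\<dots> \<le> Max ?E" using fin mem by (rule Max_ge)
  finally show "0 \<le> max_excess g1 g2 VL EL k M" by (simp add: max_excess_def)
  have "Max ?E \<in> ?E" using fin mem by (intro Max_in) auto
  then show "max_excess g1 g2 VL EL k M \<le> max_fexcess k M"
    unfolding max_excess_def using sheaf_excess_le by fastforce
qed

lemma polynomial_fun_polyfun: "p \<in> polyfun k \<Longrightarrow> (\<lambda>s :: nat \<times> 'g \<Rightarrow> 'f::comm_ring_1. p (matrix_of k s)) \<in> polynomial_fun"
  by (induction rule: polyfun.induct) (auto simp: matrix_of_def intro: polynomial_fun.intros)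

text \<open>A matrix supplies only the rows below \<open>k\<close>, so the others are frozen at
  \<open>s0\<close>. Taking for \<open>s0\<close> a point where \<open>q\<close> is nonzero keeps
  the resulting polynomial function nonzero on \<open>mats k\<close>.\<close>

lemma polyfun_polynomial_fun:
  fixes q :: "(nat \<times> 'g \<Rightarrow> 'f::comm_ring_1) \<Rightarrow> 'f"
  assumes "q \<in> polynomial_fun"
  shows "(\<lambda>M. q (\<lambda>(i, x). if i < k then M i x else s0 (i, x))) \<in> polyfun k"
  using assms
proof (induction rule: polynomial_fun.induct)
  case (polynomial_fun_var v)
  then show ?case
    by (cases v; cases "fst v < k") (auto intro: polyfun.intros)
qed (auto intro: polyfun.intros)

text \<open>For the value 0, density holds because a nonzero polynomial is nonzero at some
  L-surjective matrix and the maximum excess is never negative. For positive \<open>m\<close>, a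
  nonzero polynomial witnessing that generically \<open>max_fexcess\<close> is at most 0 vanishes on
  the whole set.\<close>

lemma generic_max_excess_rho:
  "generic_max_excess g1 g2 VL EL TYPE('f::alg_closed_field) (rho g1 g2 VL EL) = 0"
  unfolding generic_max_excess_def
proof (rule Greatest_equality)
  let ?k = "rho g1 g2 VL EL"
  show "zariski_dense ?k {M :: nat \<Rightarrow> 'g \<Rightarrow> 'f. M \<in> mats ?k \<and> L_surjective g1 g2 VL EL ?k M \<and>
      0 \<le> max_excess g1 g2 VL EL ?k M}"
    unfolding zariski_dense_def
  proof (intro conjI ballI impI)
    fix p :: "(nat \<Rightarrow> 'g \<Rightarrow> 'f) \<Rightarrow> 'f" and M :: "nat \<Rightarrow> 'g \<Rightarrow> 'f"
    assume p: "p \<in> polyfun ?k" and M: "M \<in> mats ?k"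
      and 0: "\<forall>M\<in>{M \<in> mats ?k. L_surjective g1 g2 VL EL ?k M \<and> 0 \<le> max_excess g1 g2 VL EL ?k M}. p M = 0"
    show "p M = 0"
    proof (rule ccontr)
      assume "p M \<noteq> 0"
      moreover have "matrix_of ?k (\<lambda>(i, x). M i x) = M" using M by (auto simp: matrix_of_def mats_def fun_eq_iff)
      ultimately have "p (matrix_of ?k (\<lambda>(i, x). M i x)) \<noteq> 0" by simp
      then have "generically (\<lambda>s :: nat \<times> 'g \<Rightarrow> 'f. p (matrix_of ?k s) \<noteq> 0)"
        unfolding generically_def
        by (intro bexI[OF _ polynomial_fun_polyfun[OF p]] conjI exI[of _ "\<lambda>(i, x). M i x"]) auto
      from generically_ex[OF generically_conj[OF this generic_L_surjective]]
      obtain s where "p (matrix_of ?k s) \<noteq> 0" "L_surjective g1 g2 VL EL ?k (matrix_of ?k s)"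
        by (elim exE conjE)
      then show False
        using 0 matrix_of_mats[of ?k s] max_excess_bounds(1)[of ?k "matrix_of ?k s"] by simp
    qed
  qed blast
  fix m
  assume dense: "zariski_dense ?k {M :: nat \<Rightarrow> 'g \<Rightarrow> 'f. M \<in> mats ?k \<and> L_surjective g1 g2 VL EL ?k M \<and>
      m \<le> max_excess g1 g2 VL EL ?k M}"
  show "m \<le> 0"
  proof (rule ccontr)
    assume m: "\<not> m \<le> 0"
    have "generically (\<lambda>s :: nat \<times> 'g \<Rightarrow> 'f. max_fexcess ?k (curry s) \<le> 0)"
      using generic_max_fexcess_le[of ?k] by simp
    then obtain q s0 where q: "q \<in> polynomial_fun" "q s0 \<noteq> 0" "\<And>s :: nat \<times> 'g \<Rightarrow> 'f. q s \<noteq> 0 \<Longrightarrow> max_fexcess ?k (curry s) \<le> 0"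
      unfolding generically_def by blast
    define p where "p M = q (\<lambda>(i, x). if i < ?k then M i x else s0 (i, x))" for M
    have "p \<in> polyfun ?k" unfolding p_def by (rule polyfun_polynomial_fun[OF q(1)])
    moreover have "p M = 0" if "m \<le> max_excess g1 g2 VL EL ?k M" for M
    proof (rule ccontr)
      assume "p M \<noteq> 0"
      then have "max_fexcess ?k (curry (\<lambda>(i, x). if i < ?k then M i x else s0 (i, x))) \<le> 0"
        unfolding p_def by (rule q(3))
      moreover have "max_fexcess ?k (curry (\<lambda>(i, x). if i < ?k then M i x else s0 (i, x))) = max_fexcess ?k M"
        by (rule max_fexcess_cong) simp
      ultimately show False using that m max_excess_bounds(2)[of ?k M] by linarith
    qed
    ultimately have "p (matrix_of ?k s0) = 0"
      using dense matrix_of_mats unfolding zariski_dense_def by blast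
    moreover have "(\<lambda>(i, x). if i < ?k then matrix_of ?k s0 i x else s0 (i, x)) = s0"
      by (auto simp: matrix_of_def fun_eq_iff)
    ultimately show False using q(2) by (simp add: p_def)
  qed
qed

end

theorem theorem2:
  fixes g1 g2 :: "'g::{group_add, finite}"
    and VL :: "'g set" and EL :: "('g \<times> nat) set"
  assumes "is_subgraph g1 g2 VL EL"
  shows "generic_max_excess g1 g2 VL EL TYPE('f::alg_closed_field) (rho g1 g2 VL EL) = 0"
  using assms by (intro cayley_subgraph.generic_max_excess_rho cayley_subgraph.intro)

end
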